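(* Consider a scalar frame: $m$ is a mass function with $N$ focal boxes that are intervals $A_\ell=[\underline a_\ell,\overline a_\ell]$ in $\mathbb{R}$ with masses $m_\ell$, $\ell=1,\dots,N$, so that $\bar c(m)\in\mathbb{R}$. Let $1\le K\le N$ and let $w=x^\star(m)\ge 0$ be fixed (in the scalar frame, a positive scalar). For each partition of the $N$ focal boxes into $K$ nonempty groups, let $\hat m$ be the mass function obtained by safely merging each group into one box. Then a partition into $K$ groups minimising $$w^\top\big(\bar c(\hat m)-\bar c(m)\big)$$ over all such partitions can be found exactly in $O(N^2K)$ time.
   Context: Setting: a linear combinatorial problem $\min_{x\in X}c^\top x$, $X\subseteq\{0,1\}^n$, with uncertain cost $c$ described by a mass function $m$: nonnegative masses, summing to $1$, on finitely many focal elements that are boxes $F=[\underline a_F,\overline a_F]$ (one cost interval per coordinate). In the scalar frame boxes are intervals of $\mathbb{R}$. Criterion: the lower expected cost is $\mathrm{Crit}(x;m)=\bar c(m)^\top x$ with $\bar c(m)=\sum_F m(F)\,\underline a_F$; the upper expected cost is the same with $\bar c(m)=\sum_F m(F)\,\overline a_F$. The result concerns either choice, with $\bar c$ computed from the corresponding (lower or upper) bound. The decision $x^\star(m)$ is the minimiser of $\mathrm{Crit}(\cdot\,;m)$ over $X$ (unique by a fixed tie-breaking rule). Safe merge: the safe merge of boxes $A_i,A_j$ is the box $B$ with $\underline a_B=\max(\underline a_i,\underline a_j)$ and $\overline a_B=\max(\overline a_i,\overline a_j)$ (componentwise maxima), whose mass is the sum of the two masses. Merging a group $G$ of boxes gives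 the box with lower bound $\max_{\ell\in G}\underline a_\ell$, upper bound $\max_{\ell\in G}\overline a_\ell$ and mass $\sum_{\ell\in G}m_\ell$. Running time is counted in elementary arithmetic operations and comparisons on real numbers. *)

theory Defs
  imports
    Complex_Main
    "HOL-Library.Interval"
    "HOL-Library.Disjoint_Sets"
    "HOL-Library.Landau_Symbols"
begin

section \<open>Mass functions on real intervals and safe merging\<close>

record mass_function =
  focal :: "real interval set"
  mass :: "real interval \<Rightarrow> real"

text \<open>Only the values of \<^const>\<open>mass\<close> on the focal set are meaningful. Masses are required to be
  nonnegative, so a focal interval of mass zero is allowed.\<close>

definition is_mass_function :: "mass_function \<Rightarrow> bool" where
  "is_mass_function m \<longleftrightarrow>
     finite (focal m) \<and> (\<forall>F\<in>focal m. 0 \<le> mass m F) \<and> (\<Sum>F\<in>focal m. mass m F) = 1"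

text \<open>Here \<open>bnd\<close> is \<^const>\<open>lower\<close> for the lower expected cost and \<^const>\<open>upper\<close> for the upper one.\<close>

definition cbar :: "(real interval \<Rightarrow> real) \<Rightarrow> mass_function \<Rightarrow> real" where
  "cbar bnd m = (\<Sum>F\<in>focal m. mass m F * bnd F)"

definition safe_merge :: "real interval set \<Rightarrow> real interval" where
  "safe_merge G = Interval (Max (lower ` G), Max (upper ` G))"

text \<open>Distinct groups may have the same safe merge; their masses then add up.\<close>

definition merged :: "mass_function \<Rightarrow> real interval set set \<Rightarrow> mass_function" where
  "merged m P =
     \<lparr>focal = safe_merge ` P,
      mass = (\<lambda>B. \<Sum>G | G \<in> P \<and> safe_merge G = B. \<Sum>F\<in>G. mass m F)\<rparr>"

lemma
  assumes "finite G" "G \<noteq> {}"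
  shows lower_safe_merge: "lower (safe_merge G) = Max (lower ` G)"
    and upper_safe_merge: "upper (safe_merge G) = Max (upper ` G)"
proof -
  have "Max (lower ` G) \<le> Max (upper ` G)"
  proof (rule Max.boundedI)
    fix x assume "x \<in> lower ` G"
    then obtain F where F: "F \<in> G" "x = lower F" by blast
    have "x \<le> upper F" using F by simp
    also have "\<dots> \<le> Max (upper ` G)" using F assms by simp
    finally show "x \<le> Max (upper ` G)" .
  qed (use assms in auto)
  then show "lower (safe_merge G) = Max (lower ` G)" "upper (safe_merge G) = Max (upper ` G)"
    by (simp_all add: safe_merge_def lower.rep_eq upper.rep_eq Interval_inverse)
qed

lemma safe_merge_pair:
  "lower (safe_merge {A, B}) = max (lower A) (lower B)"
  "upper (safe_merge {A, B}) = max (upper A) (upper B)"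
  by (simp_all add: lower_safe_merge upper_safe_merge)

lemma is_mass_function_merged:
  assumes "is_mass_function m" "partition_on (focal m) P"
  shows "is_mass_function (merged m P)"
proof -
  have fin: "finite (focal m)" and nonneg: "\<And>F. F \<in> focal m \<Longrightarrow> 0 \<le> mass m F"
    and one: "(\<Sum>F\<in>focal m. mass m F) = 1"
    using assms(1) by (auto simp: is_mass_function_def)
  have U: "\<Union>P = focal m" using assms(2) by (simp add: partition_on_def)
  have finP: "finite P" using finite_elements[OF fin assms(2)] .
  have "(\<Sum>B\<in>safe_merge ` P. \<Sum>G | G \<in> P \<and> safe_merge G = B. \<Sum>F\<in>G. mass m F)
      = (\<Sum>G\<in>P. \<Sum>F\<in>G. mass m F)"
    using sum.image_gen[OF finP, of "\<lambda>G. \<Sum>F\<in>G. mass m F" safe_merge] by simp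
  also have "\<dots> = (\<Sum>F\<in>\<Union>P. mass m F)"
    using assms(2) fin U
    by (subst sum.Union_disjoint)
      (auto simp: partition_on_def disjoint_def intro: finite_subset)
  finally show ?thesis
    using finP U one nonneg
    by (auto simp: is_mass_function_def merged_def intro!: sum_nonneg)
qed


section \<open>A real random access machine\<close>

text \<open>A small uniform imperative language. The memory consists of named arrays of natural numbers
  (indices, counters, labels) and of named arrays of real numbers; a scalar variable is cell 0 of
  an array. The only operations on reals are field operations and comparisons. In particular there
  is no rounding and no conversion of reals to naturals, and there is no multiplication of naturals.
  As everywhere in HOL, subtraction of naturals is truncated and \<open>x / 0 = 0\<close>.\<close>

datatype iexp =
    INum nat
  | IGet string iexp
  | IAdd iexp iexp
  | ISub iexp iexp

datatype rexp =
    RNum nat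
  | RGet string iexp
  | RAdd rexp rexp
  | RSub rexp rexp
  | RMul rexp rexp
  | RDiv rexp rexp

datatype test =
    ILess iexp iexp
  | IEq iexp iexp
  | RLess rexp rexp
  | RLeq rexp rexp

datatype com =
    Skip
  | ISet string iexp iexp  \<comment> \<open>\<open>ISet a i e\<close> is \<open>a[i] := e\<close>\<close>
  | RSet string iexp rexp
  | Seq com com
  | If test com com
  | While test com

record state =
  imem :: "string \<Rightarrow> nat \<Rightarrow> nat"
  rmem :: "string \<Rightarrow> nat \<Rightarrow> real"

primrec ival :: "state \<Rightarrow> iexp \<Rightarrow> nat" where
  "ival s (INum n) = n"
| "ival s (IGet a i) = imem s a (ival s i)"
| "ival s (IAdd i j) = ival s i + ival s j"
| "ival s (ISub i j) = ival s i - ival s j"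

primrec rval :: "state \<Rightarrow> rexp \<Rightarrow> real" where
  "rval s (RNum n) = real n"
| "rval s (RGet a i) = rmem s a (ival s i)"
| "rval s (RAdd d e) = rval s d + rval s e"
| "rval s (RSub d e) = rval s d - rval s e"
| "rval s (RMul d e) = rval s d * rval s e"
| "rval s (RDiv d e) = rval s d / rval s e"

primrec holds :: "state \<Rightarrow> test \<Rightarrow> bool" where
  "holds s (ILess i j) \<longleftrightarrow> ival s i < ival s j"
| "holds s (IEq i j) \<longleftrightarrow> ival s i = ival s j"
| "holds s (RLess d e) \<longleftrightarrow> rval s d < rval s e"
| "holds s (RLeq d e) \<longleftrightarrow> rval s d \<le> rval s e"

text \<open>Every constant, memory access, operation, comparison and control step costs one unit. Hence
  the running time is an upper bound for the number of arithmetic operations and comparisons on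
  reals, and the work on indices is not free either.\<close>

primrec icost :: "iexp \<Rightarrow> nat" where
  "icost (INum n) = 1"
| "icost (IGet a i) = 1 + icost i"
| "icost (IAdd i j) = 1 + icost i + icost j"
| "icost (ISub i j) = 1 + icost i + icost j"

primrec rcost :: "rexp \<Rightarrow> nat" where
  "rcost (RNum n) = 1"
| "rcost (RGet a i) = 1 + icost i"
| "rcost (RAdd d e) = 1 + rcost d + rcost e"
| "rcost (RSub d e) = 1 + rcost d + rcost e"
| "rcost (RMul d e) = 1 + rcost d + rcost e"
| "rcost (RDiv d e) = 1 + rcost d + rcost e"

primrec tcost :: "test \<Rightarrow> nat" where
  "tcost (ILess i j) = 1 + icost i + icost j"
| "tcost (IEq i j) = 1 + icost i + icost j"
| "tcost (RLess d e) = 1 + rcost d + rcost e"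
| "tcost (RLeq d e) = 1 + rcost d + rcost e"

definition iset :: "string \<Rightarrow> nat \<Rightarrow> nat \<Rightarrow> state \<Rightarrow> state" where
  "iset a i x s = s\<lparr>imem := (imem s)(a := (imem s a)(i := x))\<rparr>"

definition rset :: "string \<Rightarrow> nat \<Rightarrow> real \<Rightarrow> state \<Rightarrow> state" where
  "rset a i x s = s\<lparr>rmem := (rmem s)(a := (rmem s a)(i := x))\<rparr>"

text \<open>\<open>exec c s t s'\<close>: started in \<open>s\<close>, program \<open>c\<close> terminates in \<open>s'\<close> after exactly \<open>t\<close> time units.\<close>

inductive exec :: "com \<Rightarrow> state \<Rightarrow> nat \<Rightarrow> state \<Rightarrow> bool" where
  Skip: "exec Skip s 1 s"
| ISet: "exec (ISet a i e) s (1 + icost i + icost e) (iset a (ival s i) (ival s e) s)"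
| RSet: "exec (RSet a i e) s (1 + icost i + rcost e) (rset a (ival s i) (rval s e) s)"
| Seq: "exec c1 s t1 s' \<Longrightarrow> exec c2 s' t2 s'' \<Longrightarrow> exec (Seq c1 c2) s (1 + t1 + t2) s''"
| IfTrue: "holds s b \<Longrightarrow> exec c1 s t s' \<Longrightarrow> exec (If b c1 c2) s (1 + tcost b + t) s'"
| IfFalse: "\<not> holds s b \<Longrightarrow> exec c2 s t s' \<Longrightarrow> exec (If b c1 c2) s (1 + tcost b + t) s'"
| WhileFalse: "\<not> holds s b \<Longrightarrow> exec (While b c) s (1 + tcost b) s"
| WhileTrue: "holds s b \<Longrightarrow> exec c s t1 s' \<Longrightarrow> exec (While b c) s' t2 s'' \<Longrightarrow>
    exec (While b c) s (1 + tcost b + t1 + t2) s''"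

inductive_cases exec_elims:
  "exec Skip s t s'"
  "exec (ISet a i e) s t s'"
  "exec (RSet a i e) s t s'"
  "exec (Seq c1 c2) s t s'"
  "exec (If b c1 c2) s t s'"
  "exec (While b c) s t s'"

lemma exec_deterministic:
  "exec c s t s' \<Longrightarrow> exec c s u s'' \<Longrightarrow> u = t \<and> s'' = s'"
proof (induction arbitrary: u s'' rule: exec.induct)
  case (WhileTrue s b c t1 s' t2 s2)
  from WhileTrue.prems WhileTrue.hyps(1) obtain u1 r u2
    where "exec c s u1 r" "exec (While b c) r u2 s''" "u = 1 + tcost b + u1 + u2"
    by (auto elim: exec_elims(6))
  with WhileTrue.IH show ?case by blast
next
  case (Seq c1 s t1 s' c2 t2 s2)
  from Seq.prems obtain u1 r u2
    where "exec c1 s u1 r" "exec c2 r u2 s''" "u = 1 + u1 + u2"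
    by (auto elim: exec_elims(4))
  with Seq.IH show ?case by blast
next
  case (IfTrue s b c1 t s' c2)
  from IfTrue.prems IfTrue.hyps(1) obtain u1
    where "exec c1 s u1 s''" "u = 1 + tcost b + u1"
    by (auto elim: exec_elims(5))
  with IfTrue.IH show ?case by blast
next
  case (IfFalse s b c2 t s' c1)
  from IfFalse.prems IfFalse.hyps(1) obtain u1
    where "exec c2 s u1 s''" "u = 1 + tcost b + u1"
    by (auto elim: exec_elims(5))
  with IfFalse.IH show ?case by blast
qed (auto elim: exec_elims)


section \<open>Input and output conventions\<close>

text \<open>The intervals \<open>A 0, \<dots>, A (N - 1)\<close> with their masses, in the given order, are the input; all
  memory cells not used for the input are initially 0.\<close>

definition input_state :: "mass_function \<Rightarrow> nat \<Rightarrow> (nat \<Rightarrow> real interval) \<Rightarrow> nat \<Rightarrow> real \<Rightarrow> state" where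
  "input_state m N A K w =
     \<lparr>imem = (\<lambda>_ _. 0)
        (''N'' := (\<lambda>_. 0)(0 := N),
         ''K'' := (\<lambda>_. 0)(0 := K)),
      rmem = (\<lambda>_ _. 0)
        (''w'' := (\<lambda>_. 0)(0 := w),
         ''lower'' := (\<lambda>l. if l < N then lower (A l) else 0),
         ''upper'' := (\<lambda>l. if l < N then upper (A l) else 0),
         ''mass'' := (\<lambda>l. if l < N then mass m (A l) else 0))\<rparr>"

text \<open>The output is a group label below \<open>K\<close> for each index. A label that is not used yields an
  empty group, so the output is then not a partition.\<close>

definition output_groups :: "nat \<Rightarrow> (nat \<Rightarrow> real interval) \<Rightarrow> nat \<Rightarrow> state \<Rightarrow> real interval set set" where
  "output_groups N A K s = (\<lambda>k. {A l | l. l < N \<and> imem s ''group'' l = k}) ` {..<K}"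

end

theory Submission
  imports Defs
begin

text \<open>The objective equals, up to constants, \<open>\<Sum>G. mass(G) * Max (bnd ` G)\<close>. Sort the intervals
  by the chosen bound and call the last position of each group its leader. The leaders form a set
  \<open>L\<close> of \<open>K\<close> positions containing the last one, and charging every position with the bound of its next
  leader is a lower bound for the cost of the partition. This lower bound is attained by the
  partition into the consecutive blocks ended by the elements of \<open>L\<close>. So it remains to
  choose \<open>L\<close>, which a recurrence over the number of leaders and the last leader does in
  \<open>O(N\<^sup>2 K)\<close> steps, as prefix sums of the masses make the cost of a block available in
  constant time.\<close>

section \<open>Leaders\<close>

text \<open>No exchange argument turns a given partition into a consecutive one. Instead two
  inequalities sandwich the output against an arbitrary partition: its cost is at least the cost of
  its leader set, and the blocks of a leader set cost at most as much. In between, only leader sets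
  of the same size are compared. Ties between bounds, zero masses and groups with coinciding safe
  merges therefore need no special treatment. The tables are specified by the local relation
  \<open>dp_cell\<close> and not by a recursive function: minimisers need not be unique, so the
  stored choices are not determined by the input, and a partly filled memory can already satisfy the
  relation at the finished cells. That every block is nonempty, hence that the labels yield exactly
  \<open>K\<close> groups, comes from counting leaders, not from the recurrence.\<close>

definition next_leader :: "nat set \<Rightarrow> nat \<Rightarrow> nat" where
  "next_leader L p = (LEAST l. l \<in> L \<and> p \<le> l)"

definition leader_cost :: "(nat \<Rightarrow> real) \<Rightarrow> (nat \<Rightarrow> real) \<Rightarrow> nat set \<Rightarrow> nat \<Rightarrow> real" where
  "leader_cost x q L j = (\<Sum>p\<le>j. q p * x (next_leader L p))"

lemma next_leader_props:
  assumes "l \<in> L" "p \<le> l"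
  shows "next_leader L p \<in> L" "p \<le> next_leader L p" "next_leader L p \<le> l"
proof -
  have "next_leader L p \<in> L \<and> p \<le> next_leader L p"
    unfolding next_leader_def by (rule LeastI[of _ l]) (use assms in auto)
  then show "next_leader L p \<in> L" "p \<le> next_leader L p" by auto
  show "next_leader L p \<le> l" unfolding next_leader_def by (rule Least_le) (use assms in auto)
qed

lemma leader_cost_singleton: "leader_cost x q {j} j = x j * (\<Sum>p<Suc j. q p)"
proof -
  have "next_leader {j} p = j" if "p \<le> j" for p
    using next_leader_props[of j "{j}" p] that by simp
  then show ?thesis
    by (simp add: leader_cost_def lessThan_Suc_atMost sum_distrib_left mult.commute)
qed

text \<open>A leader beyond all others captures exactly the positions after the old last one;
  earlier positions keep their next leader. This makes the cost decompose over the last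
  block.\<close>

lemma leader_cost_insert:
  assumes "i \<in> L" "L \<subseteq> {..i}" "i < j"
  shows "leader_cost x q (insert j L) j
    = leader_cost x q L i + x j * ((\<Sum>p<Suc j. q p) - (\<Sum>p<Suc i. q p))"
proof -
  have low: "next_leader (insert j L) p = next_leader L p" if "p \<le> i" for p
  proof (rule antisym)
    show "next_leader (insert j L) p \<le> next_leader L p"
      using next_leader_props[of i L p] assms that by (intro next_leader_props(3)) auto
    have "next_leader (insert j L) p \<le> i" "next_leader (insert j L) p \<in> insert j L" "p \<le> next_leader (insert j L) p"
      using next_leader_props[of i "insert j L" p] assms that by auto
    then show "next_leader L p \<le> next_leader (insert j L) p"
      using assms(3) by (intro next_leader_props(3)) auto
  qed
  have high: "next_leader (insert j L) p = j" if "p \<in> {Suc i..j}" for p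
  proof -
    have "next_leader (insert j L) p \<in> insert j L" "p \<le> next_leader (insert j L) p"
      using next_leader_props[of j "insert j L" p] that by auto
    then show ?thesis using that assms(2) by fastforce
  qed
  have split: "{..j} = {..i} \<union> {Suc i..j}" "{..i} \<inter> {Suc i..j} = {}"
    using assms(3) by auto
  have q: "(\<Sum>p\<le>j. q p) - (\<Sum>p\<le>i. q p) = (\<Sum>p=Suc i..j. q p)"
    unfolding split(1) by (subst sum.union_disjoint) auto
  have "leader_cost x q (insert j L) j = leader_cost x q L i + (\<Sum>p=Suc i..j. q p * x j)"
    unfolding leader_cost_def split(1)
    by (subst sum.union_disjoint) (use low high in auto)
  then show ?thesis
    unfolding lessThan_Suc_atMost q by (simp add: sum_distrib_left mult.commute)
qed

section \<open>The recurrence\<close>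

text \<open>The value if \<open>i\<close> is the leader just before \<open>j\<close>: the block from
  \<open>Suc i\<close> to \<open>j\<close> is charged \<open>x j\<close>. Its mass appears as a
  difference of two prefix sums because these are what the program stores.\<close>

definition cand ::
  "(nat \<Rightarrow> real) \<Rightarrow> (nat \<Rightarrow> real) \<Rightarrow> (nat \<Rightarrow> nat \<Rightarrow> real) \<Rightarrow> nat \<Rightarrow> nat \<Rightarrow> nat \<Rightarrow> real" where
  "cand x q D k j i = D k i + x j * ((\<Sum>p<Suc j. q p) - (\<Sum>p<Suc i. q p))"

text \<open>\<open>D k j\<close> is meant to be the least cost of the positions up to \<open>j\<close> with \<open>k + 1\<close> leaders, the
  last of which is \<open>j\<close>; \<open>a k j\<close> is then the last but one. Only cells with \<open>k \<le> j\<close> are meaningful.\<close>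

definition dp_cell :: "(nat \<Rightarrow> real) \<Rightarrow> (nat \<Rightarrow> real) \<Rightarrow> (nat \<Rightarrow> nat \<Rightarrow> real) \<Rightarrow>
    (nat \<Rightarrow> nat \<Rightarrow> nat) \<Rightarrow> nat \<Rightarrow> nat \<Rightarrow> bool" where
  "dp_cell x q D a k j \<longleftrightarrow>
     (case k of
        0 \<Rightarrow> D 0 j = x j * (\<Sum>p<Suc j. q p)
      | Suc k' \<Rightarrow> a k j \<in> {k'..<j} \<and> D k j = cand x q D k' j (a k j) \<and>
          (\<forall>i\<in>{k'..<j}. D k j \<le> cand x q D k' j i))"

primrec leaders :: "(nat \<Rightarrow> nat \<Rightarrow> nat) \<Rightarrow> nat \<Rightarrow> nat \<Rightarrow> nat set" where
  "leaders a 0 j = {j}"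
| "leaders a (Suc k) j = insert j (leaders a k (a (Suc k) j))"

text \<open>The stored predecessor lies strictly before \<open>j\<close>, so each unfolding adds a
  fresh largest leader, and \<open>leader_cost_insert\<close> pays for its block.\<close>

lemma leaders_attain:
  assumes "\<And>k' j'. k' \<le> k \<Longrightarrow> k' \<le> j' \<Longrightarrow> j' \<le> j \<Longrightarrow> dp_cell x q D a k' j'" "k \<le> j"
  shows "j \<in> leaders a k j \<and> leaders a k j \<subseteq> {..j} \<and> card (leaders a k j) = Suc k \<and>
    D k j = leader_cost x q (leaders a k j) j"
  using assms
proof (induction k arbitrary: j)
  case 0
  then show ?case using "0.prems"(1)[of 0 j] by (simp add: dp_cell_def leader_cost_singleton)
next
  case (Suc k)
  define i where "i = a (Suc k) j"
  have c: "i \<in> {k..<j}" "D (Suc k) j = cand x q D k j i"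
    using Suc.prems(1)[of "Suc k" j] Suc.prems(2) by (auto simp: dp_cell_def i_def)
  have IH: "i \<in> leaders a k i \<and> leaders a k i \<subseteq> {..i} \<and> card (leaders a k i) = Suc k \<and>
    D k i = leader_cost x q (leaders a k i) i"
    by (rule Suc.IH) (use c Suc.prems in auto)
  then have fin: "finite (leaders a k i)" using finite_subset by blast
  have "j \<notin> leaders a k i" using IH c(1) by force
  moreover have "leaders a k i \<subseteq> {..j}" using IH c(1) by force
  ultimately show ?case
    using IH c fin leader_cost_insert[of i "leaders a k i" j x q] by (auto simp: i_def[symmetric] cand_def)
qed

text \<open>Removing \<open>j\<close> from a competing leader set leaves one that ends in some
  \<open>i\<close>. The induction hypothesis at \<open>i\<close> combines with the minimality of the
  cell over all candidates.\<close>

lemma dp_optimal: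
  assumes "\<And>k' j'. k' \<le> k \<Longrightarrow> k' \<le> j' \<Longrightarrow> j' \<le> j \<Longrightarrow> dp_cell x q D a k' j'"
    and "j \<in> L" "L \<subseteq> {..j}" "card L = Suc k"
  shows "D k j \<le> leader_cost x q L j"
  using assms
proof (induction k arbitrary: j L)
  case 0
  then have "L = {j}" by (metis One_nat_def card_1_singletonE singletonD)
  then show ?case using "0.prems"(1)[of 0 j] by (simp add: dp_cell_def leader_cost_singleton)
next
  case (Suc k)
  define M where "M = L - {j}"
  define i where "i = Max M"
  have finL: "finite L" using Suc.prems(3) finite_subset by blast
  have M: "card M = Suc k" "finite M" "L = insert j M"
    using Suc.prems finL by (auto simp: M_def)
  have i: "i \<in> M" "M \<subseteq> {..i}"
    using M card_gt_0_iff[of M] by (auto simp: i_def)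
  have "i < j" using i(1) Suc.prems(3) by (auto simp: M_def less_le)
  \<comment> \<open>\<open>Suc k\<close> leaders lie in \<open>{..i}\<close>, hence
    \<open>k \<le> i\<close>, and \<open>i\<close> is one of the candidates of the cell.\<close>
  have "Suc k \<le> Suc i" using card_mono[OF _ i(2)] M(1) by simp
  have "D (Suc k) j \<le> cand x q D k j i"
    using Suc.prems(1)[of "Suc k" j] \<open>i < j\<close> \<open>Suc k \<le> Suc i\<close> by (auto simp: dp_cell_def)
  also have "\<dots> \<le> leader_cost x q L j"
    unfolding M(3) leader_cost_insert[OF i \<open>i < j\<close>] cand_def
    using Suc.IH[of i M] Suc.prems(1) i M(1) \<open>i < j\<close> by simp
  finally show ?case .
qed

section \<open>Partitions and leaders\<close>

text \<open>Groups with the same safe merge collapse to one focal interval, but their masses add up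
  there, so the sum can be taken over groups instead.\<close>

lemma cbar_merged:
  assumes "bnd = lower \<or> bnd = upper" "finite (focal m)" "partition_on (focal m) P"
  shows "cbar bnd (merged m P) = (\<Sum>G\<in>P. \<Sum>F\<in>G. mass m F * Max (bnd ` G))"
proof -
  have finP: "finite P" using finite_elements assms(2,3) by blast
  have G: "bnd (safe_merge G) = Max (bnd ` G)" if "G \<in> P" for G
  proof -
    have "G \<noteq> {}" "finite G"
      using that assms(2,3) by (auto simp: partition_on_def intro: finite_subset)
    then show ?thesis using assms(1) lower_safe_merge upper_safe_merge by auto
  qed
  have "cbar bnd (merged m P)
    = (\<Sum>B\<in>safe_merge ` P. \<Sum>G | G \<in> P \<and> safe_merge G = B. (\<Sum>F\<in>G. mass m F) * bnd (safe_merge G))"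
    unfolding cbar_def merged_def by (auto simp: sum_distrib_right intro!: sum.cong)
  also have "\<dots> = (\<Sum>G\<in>P. (\<Sum>F\<in>G. mass m F) * bnd (safe_merge G))"
    using sum.image_gen[OF finP, of "\<lambda>G. (\<Sum>F\<in>G. mass m F) * bnd (safe_merge G)" safe_merge] by simp
  finally show ?thesis using G by (simp add: sum_distrib_right)
qed

section \<open>The leader cost as a lower bound for every partition\<close>

lemma sum_partition_enum:
  fixes f :: "'a \<Rightarrow> 'b::comm_monoid_add" and e :: "nat \<Rightarrow> 'a"
  assumes "bij_betw e {..<N} F" "partition_on F P"
  shows "(\<Sum>G\<in>P. \<Sum>y\<in>G. f y) = (\<Sum>p<N. f (e p))"
proof -
  have "finite F" using bij_betw_finite[OF assms(1)] by simp
  then have "\<forall>G\<in>P. finite G"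
    using assms(2) by (metis Sup_upper finite_subset partition_onD1)
  then have "(\<Sum>G\<in>P. \<Sum>y\<in>G. f y) = (\<Sum>y\<in>\<Union>P. f y)"
    using assms(2) by (subst sum.Union_disjoint) (auto simp: partition_on_def disjoint_def)
  also have "\<dots> = (\<Sum>p<N. f (e p))"
    using sum.reindex_bij_betw[OF assms(1), of f] assms(2) by (simp add: partition_on_def)
  finally show ?thesis .
qed

text \<open>The last position of the group containing p is a leader at or after p, hence not before
  the next leader of p; sortedness and nonnegative masses give the inequality. Disjoint groups have
  different last positions, so leaders and groups are equally many.\<close>

lemma leader_cost_le_cbar_merged:
  assumes bnd: "bnd = lower \<or> bnd = upper"
    and m: "is_mass_function m"
    and e: "bij_betw e {..<Suc n} (focal m)"
    and mono: "\<And>p p'. p \<le> p' \<Longrightarrow> p' \<le> n \<Longrightarrow> bnd (e p) \<le> bnd (e p')"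
    and P: "partition_on (focal m) P"
  obtains L where "L \<subseteq> {..n}" "n \<in> L" "card L = card P"
    "leader_cost (\<lambda>p. bnd (e p)) (\<lambda>p. mass m (e p)) L n \<le> cbar bnd (merged m P)"
proof -
  have fin: "finite (focal m)" and nonneg: "\<And>F. F \<in> focal m \<Longrightarrow> 0 \<le> mass m F"
    using m by (auto simp: is_mass_function_def)
  define r where "r = inv_into {..<Suc n} e"
  have re: "r (e p) = p" if "p \<le> n" for p
    using that e by (simp add: r_def bij_betw_def inv_into_f_f)
  have rF: "r F \<le> n" "e (r F) = F" if "F \<in> focal m" for F
  proof -
    have "F \<in> e ` {..<Suc n}" using that bij_betw_imp_surj_on[OF e] by simp
    then obtain p where "p \<le> n" "F = e p" by (blast dest: less_Suc_eq_le[THEN iffD1] lessThan_iff[THEN iffD1])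
    then show "r F \<le> n" "e (r F) = F" by (simp_all add: re)
  qed
  have G: "G \<subseteq> focal m" "finite G" "G \<noteq> {}" if "G \<in> P" for G
    using that P fin by (auto simp: partition_on_def intro: finite_subset)
  define top where "top G = Max (r ` G)" for G
  have top: "top G \<in> r ` G" "\<And>F. F \<in> G \<Longrightarrow> r F \<le> top G" if "G \<in> P" for G
    using G[OF that] by (auto simp: top_def)
  have etop: "e (top G) \<in> G" "top G \<le> n" if "G \<in> P" for G
    using top(1)[OF that] G(1)[OF that] rF by auto
  have inj: "inj_on top P"
  proof (rule inj_onI)
    fix G H assume "G \<in> P" "H \<in> P" "top G = top H"
    then have "e (top G) \<in> G \<inter> H" using etop[of G] etop[of H] by auto
    then show "G = H" using P \<open>G \<in> P\<close> \<open>H \<in> P\<close> by (auto simp: partition_on_def disjoint_def)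
  qed
  have "n \<in> top ` P"
  proof -
    have "e n \<in> \<Union>P" using P e by (auto simp: partition_on_def bij_betw_def)
    then obtain H where "H \<in> P" "e n \<in> H" by blast
    then have "n \<le> top H" using top(2)[of H "e n"] re by simp
    then show ?thesis using etop(2)[OF \<open>H \<in> P\<close>] \<open>H \<in> P\<close> by force
  qed
  moreover have "leader_cost (\<lambda>p. bnd (e p)) (\<lambda>p. mass m (e p)) (top ` P) n \<le> cbar bnd (merged m P)"
  proof -
    have "leader_cost (\<lambda>p. bnd (e p)) (\<lambda>p. mass m (e p)) (top ` P) n
      = (\<Sum>p<Suc n. mass m (e p) * bnd (e (next_leader (top ` P) (r (e p)))))"
      unfolding leader_cost_def lessThan_Suc_atMost by (intro sum.cong) (auto simp: re)
    also have "\<dots> = (\<Sum>G\<in>P. \<Sum>F\<in>G. mass m F * bnd (e (next_leader (top ` P) (r F))))"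
      by (rule sum_partition_enum[OF e P, symmetric])
    also have "\<dots> \<le> (\<Sum>G\<in>P. \<Sum>F\<in>G. mass m F * Max (bnd ` G))"
    proof (intro sum_mono mult_left_mono)
      fix G F assume GF: "G \<in> P" "F \<in> G"
      then show "0 \<le> mass m F" using nonneg G by blast
      have "next_leader (top ` P) (r F) \<le> top G"
        by (rule next_leader_props) (use GF top in auto)
      then have "bnd (e (next_leader (top ` P) (r F))) \<le> bnd (e (top G))"
        using mono etop(2) GF by blast
      also have "\<dots> \<le> Max (bnd ` G)" using etop(1) G GF by simp
      finally show "bnd (e (next_leader (top ` P) (r F))) \<le> Max (bnd ` G)" .
    qed
    finally show ?thesis using cbar_merged[OF bnd fin P] by simp
  qed
  moreover have "top ` P \<subseteq> {..n}" using etop by auto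
  moreover have "card (top ` P) = card P" using inj by (rule card_image)
  ultimately show ?thesis using that by blast
qed

text \<open>Counts the blocks that end before \<open>p\<close>. The strict inequality puts a leader
  into the block that it ends.\<close>

definition label :: "nat set \<Rightarrow> nat \<Rightarrow> nat" where
  "label L p = card {l \<in> L. l < p}"

text \<open>Has the shape of \<open>output_groups\<close>, but over an arbitrary enumeration, so
  that sorted positions can take the place of input indices.\<close>

definition fibres :: "(nat \<Rightarrow> 'a) \<Rightarrow> (nat \<Rightarrow> nat) \<Rightarrow> nat \<Rightarrow> nat \<Rightarrow> 'a set set" where
  "fibres e g N K = (\<lambda>k. {e p | p. p < N \<and> g p = k}) ` {..<K}"

lemma label_less:
  assumes "finite L" "l \<in> L" "p \<le> l" "l < p'"
  shows "label L p < label L p'"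
proof -
  have "l \<in> {l \<in> L. l < p'}" "l \<notin> {l \<in> L. l < p}" "{l \<in> L. l < p} \<subseteq> {l \<in> L. l < p'}"
    using assms by auto
  then have "{l \<in> L. l < p} \<subset> {l \<in> L. l < p'}" by blast
  then show ?thesis unfolding label_def using assms(1) by (intro psubset_card_mono) auto
qed

text \<open>Labels increase strictly along the leaders and stay below \<open>card L\<close>, since
  \<open>n\<close> is not counted at any position up to \<open>n\<close>. An injective map between
  sets of equal size is onto, so no label is left out.\<close>

lemma label_image:
  assumes "L \<subseteq> {..n}" "n \<in> L"
  shows "label L ` {..<Suc n} = {..<card L}"
proof -
  have fin: "finite L" using assms(1) by (rule finite_subset) simp
  have "{l \<in> L. l < Suc n} = L" using assms(1) by auto
  then have card: "label L (Suc n) = card L" by (simp add: label_def)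
  have lt: "label L p < card L" if "p \<le> n" for p
    using label_less[OF fin assms(2) that, of "Suc n"] card by simp
  have "inj_on (label L) L"
    using label_less[OF fin] by (intro strict_mono_on_imp_inj_on strict_mono_onI) simp
  then have "label L ` L = {..<card L}"
    using lt assms by (intro card_subset_eq) (auto simp: card_image)
  moreover have "L \<subseteq> {..<Suc n}" using assms(1) by auto
  moreover have "label L ` {..<Suc n} \<subseteq> {..<card L}" using lt by (auto simp: less_Suc_eq_le)
  ultimately show ?thesis by (metis image_mono subset_antisym)
qed

lemma partition_on_fibres:
  assumes e: "bij_betw e {..<N} F" and g: "g ` {..<N} = {..<K}"
  shows "partition_on F (fibres e g N K)" "card (fibres e g N K) = K"
proof -
  have inj: "inj_on e {..<N}" and im: "e ` {..<N} = F" using e by (auto simp: bij_betw_def)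
  have disj: "{e p | p. p < N \<and> g p = k} \<inter> {e p | p. p < N \<and> g p = k'} = {}" if "k \<noteq> k'" for k k'
    using inj that by (auto simp: inj_on_def)
  have ne: "{e p | p. p < N \<and> g p = k} \<noteq> {}" if "k < K" for k
  proof -
    have "k \<in> g ` {..<N}" using that g by simp
    then show ?thesis by auto
  qed
  have "\<Union>(fibres e g N K) = F"
  proof
    show "F \<subseteq> \<Union>(fibres e g N K)"
    proof
      fix y assume "y \<in> F"
      then obtain p where "p < N" "y = e p" using im by auto
      moreover have "g p < K" using g \<open>p < N\<close> by blast
      ultimately show "y \<in> \<Union>(fibres e g N K)" by (auto simp: fibres_def)
    qed
  qed (use im in \<open>auto simp: fibres_def\<close>)
  moreover have "disjoint (fibres e g N K)"
    unfolding disjoint_def fibres_def using disj by blast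
  moreover have "{} \<notin> fibres e g N K" using ne by (auto simp: fibres_def)
  ultimately show "partition_on F (fibres e g N K)" by (simp add: partition_on_def)
  have "inj_on (\<lambda>k. {e p | p. p < N \<and> g p = k}) {..<K}"
  proof (rule inj_onI)
    fix k k' assume "k \<in> {..<K}" "{e p | p. p < N \<and> g p = k} = {e p | p. p < N \<and> g p = k'}"
    then show "k = k'" using disj[of k k'] ne[of k] by auto
  qed
  then show "card (fibres e g N K) = K" unfolding fibres_def by (subst card_image) simp_all
qed

text \<open>A leader between two positions would separate their labels. So no member of a block lies
  beyond the next leader of another member, and the bound there dominates the whole block.\<close>

lemma cbar_fibres_le:
  assumes bnd: "bnd = lower \<or> bnd = upper"
    and m: "is_mass_function m"
    and e: "bij_betw e {..<Suc n} (focal m)"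
    and mono: "\<And>p p'. p \<le> p' \<Longrightarrow> p' \<le> n \<Longrightarrow> bnd (e p) \<le> bnd (e p')"
    and L: "L \<subseteq> {..n}" "n \<in> L"
  shows "cbar bnd (merged m (fibres e (label L) (Suc n) (card L)))
    \<le> leader_cost (\<lambda>p. bnd (e p)) (\<lambda>p. mass m (e p)) L n"
proof -
  have fin: "finite (focal m)" and nonneg: "\<And>F. F \<in> focal m \<Longrightarrow> 0 \<le> mass m F"
    using m by (auto simp: is_mass_function_def)
  have finL: "finite L" using L finite_subset by blast
  define r where "r = inv_into {..<Suc n} e"
  have re: "r (e p) = p" if "p \<le> n" for p
    using that e by (simp add: r_def bij_betw_def inv_into_f_f)
  let ?P = "fibres e (label L) (Suc n) (card L)"
  have P: "partition_on (focal m) ?P"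
    by (rule partition_on_fibres(1)[OF e label_image[OF L]])
  have "cbar bnd (merged m ?P) = (\<Sum>G\<in>?P. \<Sum>F\<in>G. mass m F * Max (bnd ` G))"
    by (rule cbar_merged[OF bnd fin P])
  also have "\<dots> \<le> (\<Sum>G\<in>?P. \<Sum>F\<in>G. mass m F * bnd (e (next_leader L (r F))))"
  proof (intro sum_mono mult_left_mono)
    fix G F assume GF: "G \<in> ?P" "F \<in> G"
    have sub: "G \<subseteq> focal m" using GF(1) P by (auto simp: partition_on_def)
    then show "0 \<le> mass m F" using nonneg GF by blast
    have finG: "finite G" using sub fin finite_subset by blast
    obtain p where p: "p \<le> n" "F = e p" and G: "G = {e p' | p'. p' < Suc n \<and> label L p' = label L p}"
      using GF by (fastforce simp: fibres_def less_Suc_eq_le)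
    have nx: "next_leader L p \<in> L" "p \<le> next_leader L p" "next_leader L p \<le> n" using next_leader_props[of n L p] L p by auto
    show "Max (bnd ` G) \<le> bnd (e (next_leader L (r F)))"
    proof (rule Max.boundedI)
      fix z assume "z \<in> bnd ` G"
      then obtain p' where p': "p' \<le> n" "label L p' = label L p" "z = bnd (e p')"
        unfolding G by (fastforce simp: less_Suc_eq_le)
      have "\<not> next_leader L p < p'"
      proof
        assume "next_leader L p < p'"
        then show False using label_less[OF finL nx(1,2), of p'] p'(2) by simp
      qed
      then show "z \<le> bnd (e (next_leader L (r F)))" using p(2) p'(3) nx(3) mono[of p' "next_leader L p"] re[OF p(1)] by simp
    qed (use finG GF in auto)
  qed
  also have "\<dots> = (\<Sum>p<Suc n. mass m (e p) * bnd (e (next_leader L (r (e p)))))"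
    by (rule sum_partition_enum[OF e P])
  also have "\<dots> = leader_cost (\<lambda>p. bnd (e p)) (\<lambda>p. mass m (e p)) L n"
    unfolding leader_cost_def lessThan_Suc_atMost by (intro sum.cong) (auto simp: re)
  finally show ?thesis .
qed

section \<open>Ranks\<close>

text \<open>Breaking ties by the index makes the order strict and total, so equal bounds still get
  different ranks.\<close>

definition rank :: "(nat \<Rightarrow> real) \<Rightarrow> nat \<Rightarrow> nat \<Rightarrow> nat" where
  "rank v N i = card {j. j < N \<and> (v j < v i \<or> v j = v i \<and> j < i)}"

lemma rank_less:
  assumes "i < N" "v i < v i' \<or> v i = v i' \<and> i < i'"
  shows "rank v N i < rank v N i'"
  unfolding rank_def by (rule psubset_card_mono) (use assms in auto)

lemma bij_betw_rank: "bij_betw (rank v N) {..<N} {..<N}"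
proof -
  have "inj_on (rank v N) {..<N}"
  proof (rule inj_onI)
    fix i i' assume "i \<in> {..<N}" "i' \<in> {..<N}" "rank v N i = rank v N i'"
    then show "i = i'"
      using rank_less[of i N v i'] rank_less[of i' N v i]
      by (cases "v i" "v i'" rule: linorder_cases; cases i i' rule: linorder_cases) auto
  qed
  moreover have "rank v N i < N" if "i < N" for i
  proof -
    have "card {j. j < N \<and> (v j < v i \<or> v j = v i \<and> j < i)} < card {..<N}"
      by (rule psubset_card_mono) (use that in auto)
    then show ?thesis by (simp add: rank_def)
  qed
  ultimately show ?thesis
    using endo_inj_surj[of "{..<N}" "rank v N"] by (auto simp: bij_betw_def)
qed

lemma rank_le_imp:
  assumes "i < N" "i' < N" "rank v N i \<le> rank v N i'"
  shows "v i \<le> v i'"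
  using rank_less[of i' N v i] assms by (meson leD leI)

section \<open>Program logic\<close>

text \<open>Total correctness with time. The postcondition takes the elapsed time as an argument, so
  sequencing passes costs on and loop-free code is evaluated by rewriting.\<close>

definition run :: "com \<Rightarrow> state \<Rightarrow> (nat \<Rightarrow> state \<Rightarrow> bool) \<Rightarrow> bool" where
  "run c s Q \<longleftrightarrow> (\<exists>t s'. exec c s t s' \<and> Q t s')"

lemma run_simps [simp]:
  "run Skip s Q \<longleftrightarrow> Q 1 s"
  "run (ISet a i e) s Q \<longleftrightarrow> Q (1 + icost i + icost e) (iset a (ival s i) (ival s e) s)"
  "run (RSet a i d) s Q \<longleftrightarrow> Q (1 + icost i + rcost d) (rset a (ival s i) (rval s d) s)"
  "run (Seq c1 c2) s Q \<longleftrightarrow> run c1 s (\<lambda>t1 s'. run c2 s' (\<lambda>t2. Q (1 + t1 + t2)))"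
  "run (If b c1 c2) s Q \<longleftrightarrow>
    (if holds s b then run c1 s (\<lambda>t. Q (1 + tcost b + t)) else run c2 s (\<lambda>t. Q (1 + tcost b + t)))"
  unfolding run_def by (auto 4 3 intro: exec.intros[simplified] elim!: exec_elims)

lemma mem_simps [simp]:
  "imem (iset a i x s) b = (if b = a then (imem s a)(i := x) else imem s b)"
  "rmem (iset a i x s) = rmem s"
  "rmem (rset a i y s) b = (if b = a then (rmem s a)(i := y) else rmem s b)"
  "imem (rset a i y s) = imem s"
  by (auto simp: iset_def rset_def)

abbreviation ivar :: "string \<Rightarrow> iexp" where "ivar x \<equiv> IGet x (INum 0)"
abbreviation rvar :: "string \<Rightarrow> rexp" where "rvar x \<equiv> RGet x (INum 0)"
abbreviation iput :: "string \<Rightarrow> iexp \<Rightarrow> com" where "iput x \<equiv> ISet x (INum 0)"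
abbreviation rput :: "string \<Rightarrow> rexp \<Rightarrow> com" where "rput x \<equiv> RSet x (INum 0)"
abbreviation iinc :: "string \<Rightarrow> com" where "iinc x \<equiv> iput x (IAdd (ivar x) (INum 1))"
abbreviation seq :: "com \<Rightarrow> com \<Rightarrow> com" (infixr ";;" 60) where "c1 ;; c2 \<equiv> Seq c1 c2"

section \<open>Counting loops with a time bound\<close>

definition for_loop :: "string \<Rightarrow> iexp \<Rightarrow> string \<Rightarrow> com \<Rightarrow> com" where
  "for_loop x lo n c = (iput x lo ;; While (ILess (ivar x) (ivar n)) (c ;; iinc x))"

text \<open>A test costs 6 units including the loop step, and sequencing with the increment costs 7.
  This gives 13 units of overhead per iteration and 6 for the final failing test.\<close>

lemma run_while:
  assumes "l \<le> h" "I l s" "imem s x 0 = l"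
    and var: "\<And>i s. I i s \<Longrightarrow> imem s n 0 = h"
    and step: "\<And>i s. l \<le> i \<Longrightarrow> i < h \<Longrightarrow> I i s \<Longrightarrow> imem s x 0 = i \<Longrightarrow>
      run c s (\<lambda>t s'. t \<le> B \<and> imem s' x 0 = i \<and> I (Suc i) (iset x 0 (Suc i) s'))"
  shows "run (While (ILess (ivar x) (ivar n)) (c ;; iinc x)) s
    (\<lambda>t s'. t \<le> 6 + (h - l) * (B + 13) \<and> I h s' \<and> imem s' x 0 = h)"
  using assms(1-3) step
proof (induction "h - l" arbitrary: l s)
  case 0
  then have "\<not> holds s (ILess (ivar x) (ivar n))" using var by auto
  from WhileFalse[OF this, of "c ;; iinc x"]
  have "exec (While (ILess (ivar x) (ivar n)) (c ;; iinc x)) s 6 s" by (simp add: eval_nat_numeral)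
  then show ?case
    using 0 unfolding run_def by (intro exI[of _ 6] exI[of _ s]) auto
next
  case (Suc d)
  then have "l < h" by simp
  then have b: "holds s (ILess (ivar x) (ivar n))" using var Suc.prems by auto
  from Suc.prems(4)[OF order_refl \<open>l < h\<close> Suc.prems(2,3)] obtain t1 s1
    where 1: "exec c s t1 s1" "t1 \<le> B" "imem s1 x 0 = l" "I (Suc l) (iset x 0 (Suc l) s1)"
    by (auto simp: run_def)
  define s2 where "s2 = iset x 0 (Suc l) s1"
  have 2: "exec (c ;; iinc x) s (1 + t1 + 6) s2"
    using exec.Seq[OF 1(1) exec.ISet[of x "INum 0" "IAdd (ivar x) (INum 1)" s1]] 1(3)
    by (simp add: s2_def eval_nat_numeral)
  have "run (While (ILess (ivar x) (ivar n)) (c ;; iinc x)) s2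
    (\<lambda>t s'. t \<le> 6 + (h - Suc l) * (B + 13) \<and> I h s' \<and> imem s' x 0 = h)"
  proof (rule Suc.hyps(1))
    show "d = h - Suc l" "Suc l \<le> h" using Suc.hyps(2) by auto
    show "I (Suc l) s2" "imem s2 x 0 = Suc l" using 1 by (auto simp: s2_def)
  qed (use Suc.prems(4) in auto)
  then obtain t2 s3 where 3: "exec (While (ILess (ivar x) (ivar n)) (c ;; iinc x)) s2 t2 s3"
    "t2 \<le> 6 + (h - Suc l) * (B + 13)" "I h s3" "imem s3 x 0 = h" by (auto simp: run_def)
  have "h - l = Suc (h - Suc l)" using \<open>l < h\<close> by simp
  then have "1 + tcost (ILess (ivar x) (ivar n)) + (1 + t1 + 6) + t2 \<le> 6 + (h - l) * (B + 13)"
    using 1(2) 3(2) by simp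
  then show ?case using WhileTrue[OF b 2 3(1)] 3(3,4) unfolding run_def by blast
qed

text \<open>The 9 units are the final test and the overhead of the initial assignment. The iteration
  count \<open>h - l\<close> is weakened to \<open>h\<close>, which is enough for the asymptotic
  bound.\<close>

lemma run_for:
  assumes "ival s lo = l" "l \<le> h" "I l (iset x 0 l s)"
    and "\<And>i s. I i s \<Longrightarrow> imem s n 0 = h"
    and "\<And>i s. l \<le> i \<Longrightarrow> i < h \<Longrightarrow> I i s \<Longrightarrow> imem s x 0 = i \<Longrightarrow>
      run c s (\<lambda>t s'. t \<le> B \<and> imem s' x 0 = i \<and> I (Suc i) (iset x 0 (Suc i) s'))"
    and Q: "\<And>t s'. t \<le> 9 + icost lo + h * (B + 13) \<Longrightarrow> I h s' \<Longrightarrow> Q t s'"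
  shows "run (for_loop x lo n c) s Q"
proof -
  have "run (While (ILess (ivar x) (ivar n)) (c ;; iinc x)) (iset x 0 l s)
    (\<lambda>t s'. t \<le> 6 + (h - l) * (B + 13) \<and> I h s' \<and> imem s' x 0 = h)"
    by (rule run_while) (use assms in auto)
  then obtain t s' where w: "exec (While (ILess (ivar x) (ivar n)) (c ;; iinc x)) (iset x 0 l s) t s'"
    "t \<le> 6 + (h - l) * (B + 13)" "I h s'" by (auto simp: run_def)
  have "(h - l) * (B + 13) \<le> h * (B + 13)" by (intro mult_right_mono) auto
  then have "1 + (1 + icost (INum 0) + icost lo) + t \<le> 9 + icost lo + h * (B + 13)"
    using w(2) by (simp add: algebra_simps)
  moreover have "exec (iput x lo) s (1 + icost (INum 0) + icost lo) (iset x 0 l s)"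
    using exec.ISet[of x "INum 0" lo s] assms(1) by simp
  then have "exec (for_loop x lo n c) s (1 + (1 + icost (INum 0) + icost lo) + t) s'"
    unfolding for_loop_def using w(1) by (rule exec.Seq)
  ultimately show ?thesis using Q w(3) unfolding run_def by blast
qed

section \<open>Frame conditions: the names that a program may change\<close>

definition same_off :: "string set \<Rightarrow> state \<Rightarrow> state \<Rightarrow> bool" where
  "same_off X s s0 \<longleftrightarrow> (\<forall>a. a \<notin> X \<longrightarrow> imem s a = imem s0 a \<and> rmem s a = rmem s0 a)"

lemma same_off_update [simp]:
  "a \<in> X \<Longrightarrow> same_off X (iset a i x s) s0 = same_off X s s0"
  "a \<in> X \<Longrightarrow> same_off X (rset a i y s) s0 = same_off X s s0"
  by (auto simp: same_off_def)

lemma same_off_refl [simp]: "same_off X s s"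
  by (simp add: same_off_def)

lemma same_off_trans: "same_off X s s1 \<Longrightarrow> same_off Y s1 s0 \<Longrightarrow> X \<subseteq> Z \<Longrightarrow> Y \<subseteq> Z \<Longrightarrow> same_off Z s s0"
  unfolding same_off_def by (metis subsetD)

lemma same_offD:
  "same_off X s s0 \<Longrightarrow> a \<notin> X \<Longrightarrow> imem s a = imem s0 a"
  "same_off X s s0 \<Longrightarrow> a \<notin> X \<Longrightarrow> rmem s a = rmem s0 a"
  by (auto simp: same_off_def)

section \<open>Sorting\<close>

text \<open>Counting the smaller elements puts every interval at its final position at once, so that
  no in-place sorting has to be verified.\<close>

definition sort_prog :: "string \<Rightarrow> com" where
  "sort_prog v = for_loop ''i'' (INum 0) ''N''
     (iput ''r'' (INum 0) ;;
      for_loop ''j'' (INum 0) ''N''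
        (If (RLess (RGet v (ivar ''j'')) (RGet v (ivar ''i''))) (iinc ''r'')
          (If (RLeq (RGet v (ivar ''j'')) (RGet v (ivar ''i'')))
            (If (ILess (ivar ''j'') (ivar ''i'')) (iinc ''r'') Skip) Skip)) ;;
      ISet ''pos'' (ivar ''r'') (ivar ''i'') ;;
      RSet ''x'' (ivar ''r'') (RGet v (ivar ''i'')) ;;
      RSet ''q'' (ivar ''r'') (RGet ''mass'' (ivar ''i'')))"

text \<open>Once \<open>RLess\<close> has failed, \<open>RLeq\<close> amounts to equality of the two
  bounds, and the index comparison decides. The register thus counts the predecessors of
  \<open>i\<close> among the first \<open>j\<close> indices.\<close>

lemma run_rank:
  fixes vn :: string
  assumes N: "imem s0 ''N'' 0 = N" and i: "imem s0 ''i'' 0 = i" and r: "imem s0 ''r'' 0 = 0"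
    and Q: "\<And>t s. t \<le> 10 + N * 47 \<Longrightarrow> same_off {''r'', ''j''} s s0 \<Longrightarrow>
      imem s ''r'' 0 = rank (rmem s0 vn) N i \<Longrightarrow> Q t s"
    and vn: "v = rmem s0 vn" "vn = ''lower'' \<or> vn = ''upper''"
  shows "run (for_loop ''j'' (INum 0) ''N''
        (If (RLess (RGet vn (ivar ''j'')) (RGet vn (ivar ''i''))) (iinc ''r'')
          (If (RLeq (RGet vn (ivar ''j'')) (RGet vn (ivar ''i'')))
            (If (ILess (ivar ''j'') (ivar ''i'')) (iinc ''r'') Skip) Skip))) s0 Q"
proof (rule run_for[where h = N and l = 0 and B = 34 and
    I = "\<lambda>j s. same_off {''r'', ''j''} s s0 \<and> imem s ''r'' 0 = card {j'. j' < j \<and> (v j' < v i \<or> v j' = v i \<and> j' < i)}"])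
  fix j s
  assume I: "same_off {''r'', ''j''} s s0 \<and> imem s ''r'' 0 = card {j'. j' < j \<and> (v j' < v i \<or> v j' = v i \<and> j' < i)}"
    and j: "imem s ''j'' 0 = j"
  have off: "imem s a = imem s0 a" "rmem s a = rmem s0 a" if "a \<notin> {''r'', ''j''}" for a
    using I that by (auto simp: same_offD)
  have v: "rmem s vn = v" using vn off(2)[of vn] by auto
  have c: "card {j'. j' < Suc j \<and> (v j' < v i \<or> v j' = v i \<and> j' < i)}
    = card {j'. j' < j \<and> (v j' < v i \<or> v j' = v i \<and> j' < i)} + (if v j < v i \<or> v j = v i \<and> j < i then 1 else 0)"
  proof -
    have "{j'. j' < Suc j \<and> (v j' < v i \<or> v j' = v i \<and> j' < i)}
      = (if v j < v i \<or> v j = v i \<and> j < i then insert j else id) {j'. j' < j \<and> (v j' < v i \<or> v j' = v i \<and> j' < i)}"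
      by (auto simp: less_Suc_eq)
    then show ?thesis by simp
  qed
  show "run (If (RLess (RGet vn (ivar ''j'')) (RGet vn (ivar ''i''))) (iinc ''r'')
          (If (RLeq (RGet vn (ivar ''j'')) (RGet vn (ivar ''i'')))
            (If (ILess (ivar ''j'') (ivar ''i'')) (iinc ''r'') Skip) Skip)) s
     (\<lambda>t s'. t \<le> 34 \<and> imem s' ''j'' 0 = j \<and> same_off {''r'', ''j''} (iset ''j'' 0 (Suc j) s') s0 \<and>
        imem (iset ''j'' 0 (Suc j) s') ''r'' 0 = card {j'. j' < Suc j \<and> (v j' < v i \<or> v j' = v i \<and> j' < i)})"
    using I by (auto simp: j v off i c)
qed (use N r Q in \<open>auto simp: same_offD rank_def vn\<close>)


lemma run_sort:
  assumes N: "imem s0 ''N'' 0 = N" and vn: "vn = ''lower'' \<or> vn = ''upper''"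
    and Q: "\<And>t s. t \<le> 10 + N * (N * 47 + 50) \<Longrightarrow>
      same_off {''i'', ''r'', ''j'', ''pos'', ''x'', ''q''} s s0 \<Longrightarrow>
      (\<And>i. i < N \<Longrightarrow> imem s ''pos'' (rank (rmem s0 vn) N i) = i \<and>
         rmem s ''x'' (rank (rmem s0 vn) N i) = rmem s0 vn i \<and>
         rmem s ''q'' (rank (rmem s0 vn) N i) = rmem s0 ''mass'' i) \<Longrightarrow> Q t s"
  shows "run (sort_prog vn) s0 Q"
  unfolding sort_prog_def
proof (rule run_for[where h = N and l = 0 and B = "N * 47 + 37" and
    I = "\<lambda>i s. same_off {''i'', ''r'', ''j'', ''pos'', ''x'', ''q''} s s0 \<and>
      (\<forall>i'<i. imem s ''pos'' (rank (rmem s0 vn) N i') = i' \<and>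
         rmem s ''x'' (rank (rmem s0 vn) N i') = rmem s0 vn i' \<and>
         rmem s ''q'' (rank (rmem s0 vn) N i') = rmem s0 ''mass'' i')"], goal_cases)
  case (5 i s)
  define v where "v = rmem s0 vn"
  have off: "imem s a = imem s0 a" "rmem s a = rmem s0 a" if "a \<notin> {''i'', ''r'', ''j'', ''pos'', ''x'', ''q''}" for a
    using 5(3) that by (auto simp: same_offD)
  have v: "rmem s vn = v" using vn off(2)[of vn] by (auto simp: v_def)
  \<comment> \<open>Different indices have different ranks, so entries placed earlier are not
    overwritten.\<close>
  have inj: "rank v N i' \<noteq> rank v N i" if "i' < i" for i'
    using bij_betw_rank[of v N] that 5(2) by (auto simp: bij_betw_def inj_on_def)
  show ?case
    unfolding run_simps
  proof (rule run_rank[where N = N and i = i and v = v], goal_cases)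
    case (4 t s')
    note r = this
    have off': "imem s' a = imem s a" "rmem s' a = rmem s a" if "a \<notin> {''r'', ''j''}" for a
      using same_offD[OF r(2) that] that by auto
    have "same_off {''i'', ''r'', ''j'', ''pos'', ''x'', ''q''} s' s0"
      using r(2) 5(3) by (auto simp: same_off_def)
    then show ?case
      using r(1,3) inj 5(3,4) vn by (auto simp: less_Suc_eq off off' v v_def)
  qed (use 5 vn N off v in auto)
next
  case (6 t s)
  then show ?case by (intro Q) (auto simp: algebra_simps)
qed (use N in \<open>auto simp: same_offD\<close>)

section \<open>Prefix sums\<close>

text \<open>Cell \<open>p\<close> of \<open>S\<close> sums the masses strictly before position
  \<open>p\<close>, so \<open>S\<close> has one entry more than there are positions. The same pass
  fills row 0 of \<open>D\<close>, where a single leader is charged with everything up to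
  it.\<close>

definition prefix_prog :: com where
  "prefix_prog = RSet ''S'' (INum 0) (RNum 0) ;;
     for_loop ''p'' (INum 0) ''N''
       (RSet ''S'' (IAdd (ivar ''p'') (INum 1)) (RAdd (RGet ''S'' (ivar ''p'')) (RGet ''q'' (ivar ''p''))) ;;
        RSet ''D'' (ivar ''p'')
          (RMul (RGet ''x'' (ivar ''p'')) (RGet ''S'' (IAdd (ivar ''p'') (INum 1)))))"

lemma run_prefix:
  assumes N: "imem s0 ''N'' 0 = N"
    and Q: "\<And>t s. t \<le> 20 + N * 50 \<Longrightarrow> same_off {''p'', ''S'', ''D''} s s0 \<Longrightarrow>
      (\<And>p. p \<le> N \<Longrightarrow> rmem s ''S'' p = sum (rmem s0 ''q'') {..<p}) \<Longrightarrow>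
      (\<And>p. p < N \<Longrightarrow> rmem s ''D'' p = rmem s0 ''x'' p * sum (rmem s0 ''q'') {..<Suc p}) \<Longrightarrow> Q t s"
  shows "run prefix_prog s0 Q"
  unfolding prefix_prog_def run_simps
proof (rule run_for[where h = N and l = 0 and B = 37 and
    I = "\<lambda>i s. same_off {''p'', ''S'', ''D''} s s0 \<and>
      (\<forall>p\<le>i. rmem s ''S'' p = sum (rmem s0 ''q'') {..<p}) \<and>
      (\<forall>p<i. rmem s ''D'' p = rmem s0 ''x'' p * sum (rmem s0 ''q'') {..<Suc p})"], goal_cases)
  case (5 i s)
  then show ?case by (auto simp: same_offD le_Suc_eq less_Suc_eq)
next
  case (6 t s)
  then show ?case by (intro Q) auto
qed (use N in \<open>auto simp: same_offD\<close>)

section \<open>Dynamic programming\<close>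

definition cand_exp :: "iexp \<Rightarrow> rexp" where
  "cand_exp e = RAdd (RGet ''D'' (IAdd (ivar ''p'') e))
     (RMul (RGet ''x'' (ivar ''j''))
       (RSub (RGet ''S'' (IAdd (ivar ''j'') (INum 1))) (RGet ''S'' (IAdd e (INum 1)))))"

text \<open>The candidate \<open>k - 1\<close> is evaluated before the loop, so the running minimum
  needs no infinite initial value.\<close>

definition best_prog :: com where
  "best_prog =
     rput ''best'' (cand_exp (ISub (ivar ''k'') (INum 1))) ;;
     iput ''arg'' (ISub (ivar ''k'') (INum 1)) ;;
     for_loop ''i'' (ivar ''k'') ''j''
       (If (RLess (cand_exp (ivar ''i'')) (rvar ''best''))
          (rput ''best'' (cand_exp (ivar ''i'')) ;; iput ''arg'' (ivar ''i'')) Skip)"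

lemma run_best:
  assumes k: "imem s0 ''k'' 0 = Suc k" and j: "imem s0 ''j'' 0 = j" "k < j"
    and c: "\<And>i. i < j \<Longrightarrow> c i = rmem s0 ''D'' (imem s0 ''p'' 0 + i) +
      rmem s0 ''x'' j * (rmem s0 ''S'' (Suc j) - rmem s0 ''S'' (Suc i))"
    and Q: "\<And>t s. t \<le> 50 + j * 70 \<Longrightarrow> same_off {''i'', ''best'', ''arg''} s s0 \<Longrightarrow>
      imem s ''arg'' 0 \<in> {k..<j} \<Longrightarrow> rmem s ''best'' 0 = c (imem s ''arg'' 0) \<Longrightarrow>
      (\<And>i. i \<in> {k..<j} \<Longrightarrow> rmem s ''best'' 0 \<le> c i) \<Longrightarrow> Q t s"
  shows "run best_prog s0 Q"
  unfolding best_prog_def run_simps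
\<comment> \<open>An improving iteration evaluates the candidate twice, at 22 units each; all its
  work stays below 57.\<close>
proof (rule run_for[where h = j and l = "Suc k" and B = 57 and
    I = "\<lambda>i s. same_off {''i'', ''best'', ''arg''} s s0 \<and>
      imem s ''arg'' 0 \<in> {k..<i} \<and> rmem s ''best'' 0 = c (imem s ''arg'' 0) \<and>
      (\<forall>i'\<in>{k..<i}. rmem s ''best'' 0 \<le> c i')"], goal_cases)
  case (5 i s)
  have off: "imem s a = imem s0 a" "rmem s a = rmem s0 a" if "a \<notin> {''i'', ''best'', ''arg''}" for a
    using 5(3) that by (auto simp: same_offD)
  have e: "rval s (cand_exp (ivar ''i'')) = c i"
    using 5(2,4) off j by (simp add: cand_exp_def c)
  have e': "rcost (cand_exp (ivar ''i'')) = 22" by (simp add: cand_exp_def)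
  have "c i \<le> c i'" if "c i < rmem s ''best'' 0" "i' \<in> {k..<i}" for i'
    using 5(3) that by force
  then show ?case using 5 j by (auto simp: e e' less_Suc_eq)
next
  case 3
  then show ?case using k j by (auto simp: cand_exp_def c)
next
  case (6 t s)
  then show ?case using j by (intro Q) (auto simp: cand_exp_def)
qed (use k j in \<open>auto simp: same_offD cand_exp_def\<close>)

lemma cell_index_eq:
  fixes j j' N :: nat
  assumes "j < N" "j' < N"
  shows "k * N + j = k' * N + j' \<longleftrightarrow> k = k' \<and> j = j'"
proof
  assume "k * N + j = k' * N + j'"
  then have "(k * N + j) div N = (k' * N + j') div N" "(k * N + j) mod N = (k' * N + j') mod N" by auto
  then show "k = k' \<and> j = j'" using assms by simp
qed simp

text \<open>The machine cannot multiply naturals: the programs below keep the offset \<open>k * N\<close> of the current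
  row of the flat tables in \<open>b\<close>, and that of the previous row in \<open>p\<close>.\<close>

abbreviation cell :: "nat \<Rightarrow> state \<Rightarrow> (nat \<Rightarrow> real) \<Rightarrow> (nat \<Rightarrow> real) \<Rightarrow> nat \<Rightarrow> nat \<Rightarrow> bool" where
  "cell N s x q \<equiv> dp_cell x q (\<lambda>k j. rmem s ''D'' (k * N + j)) (\<lambda>k j. imem s ''a'' (k * N + j))"

text \<open>A cell refers only to its own entries and to earlier columns of the previous row. Hence
  filling the table row by row never disturbs a finished cell.\<close>

lemma cell_cong:
  assumes "j < N" "\<And>k' j'. k' \<le> k \<Longrightarrow> j' \<le> j \<Longrightarrow>
    rmem s' ''D'' (k' * N + j') = rmem s ''D'' (k' * N + j')"
    "imem s' ''a'' (k * N + j) = imem s ''a'' (k * N + j)"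
  shows "cell N s' x q k j \<longleftrightarrow> cell N s x q k j"
proof (cases k)
  case 0
  then show ?thesis using assms(2)[of 0 j] by (simp add: dp_cell_def)
next
  case (Suc k')
  have "cand x q (\<lambda>k j. rmem s' ''D'' (k * N + j)) k' j i = cand x q (\<lambda>k j. rmem s ''D'' (k * N + j)) k' j i"
    if "i < j" for i using assms(2)[of k' i] that Suc by (simp add: cand_def)
  then show ?thesis using assms(2)[of k j] assms(3) Suc by (auto simp: dp_cell_def)
qed

definition row_prog :: com where
  "row_prog = for_loop ''j'' (ivar ''k'') ''N''
     (best_prog ;;
      RSet ''D'' (IAdd (ivar ''b'') (ivar ''j'')) (rvar ''best'') ;;
      ISet ''a'' (IAdd (ivar ''b'') (ivar ''j'')) (ivar ''arg''))"

lemma run_row: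
  assumes N: "imem s0 ''N'' 0 = N" and k: "imem s0 ''k'' 0 = Suc k" "Suc k \<le> N"
    and p: "imem s0 ''p'' 0 = k * N" and b: "imem s0 ''b'' 0 = Suc k * N"
    and x: "x = rmem s0 ''x''" and S: "\<And>p. p \<le> N \<Longrightarrow> rmem s0 ''S'' p = sum q {..<p}"
    and cells: "\<And>k' j'. k' \<le> k \<Longrightarrow> k' \<le> j' \<Longrightarrow> j' < N \<Longrightarrow> cell N s0 x q k' j'"
    and Q: "\<And>t s. t \<le> 20 + N * (100 + N * 70) \<Longrightarrow>
      same_off {''i'', ''best'', ''arg'', ''j'', ''D'', ''a''} s s0 \<Longrightarrow>
      (\<And>k' j'. k' \<le> Suc k \<Longrightarrow> k' \<le> j' \<Longrightarrow> j' < N \<Longrightarrow> cell N s x q k' j') \<Longrightarrow> Q t s"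
  shows "run row_prog s0 Q"
  unfolding row_prog_def
proof (rule run_for[where h = N and l = "Suc k" and B = "87 + N * 70" and
    I = "\<lambda>j s. same_off {''i'', ''best'', ''arg'', ''j'', ''D'', ''a''} s s0 \<and>
      (\<forall>k' j'. k' \<le> j' \<and> j' < N \<and> (k' \<le> k \<or> k' = Suc k \<and> j' < j) \<longrightarrow> cell N s x q k' j')"], goal_cases)
  case (5 j s)
  have off: "imem s a = imem s0 a" "rmem s a = rmem s0 a"
    if "a \<notin> {''i'', ''best'', ''arg'', ''j'', ''D'', ''a''}" for a
    using 5(3) that by (auto simp: same_offD)
  let ?D = "\<lambda>k j. rmem s ''D'' (k * N + j)"
  show ?case
    unfolding run_simps
  proof (rule run_best[where k = k and j = j and c = "cand x q ?D k j"], goal_cases)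
    case (5 t s')
    note b5 = this
    have off': "imem s' a = imem s a" "rmem s' a = rmem s a" if "a \<notin> {''i'', ''best'', ''arg''}" for a
      using b5(2) that by (auto simp: same_offD)
    define s3 where "s3 = iset ''a'' (Suc k * N + j) (imem s' ''arg'' 0)
      (rset ''D'' (Suc k * N + j) (rmem s' ''best'' 0) s')"
    have s3: "rmem s3 ''D'' = (rmem s ''D'')(Suc k * N + j := rmem s' ''best'' 0)"
      "imem s3 ''a'' = (imem s ''a'')(Suc k * N + j := imem s' ''arg'' 0)"
      by (simp_all add: s3_def off')
    have old: "cell N s3 x q k' j'" if "k' \<le> j'" "j' < N" "k' \<le> k \<or> k' = Suc k \<and> j' < j" for k' j'
    proof -
      have "cell N s3 x q k' j' \<longleftrightarrow> cell N s x q k' j'"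
        using that \<open>j < N\<close>
        by (intro cell_cong) (auto simp: s3 cell_index_eq simp del: mult_Suc)
      then show ?thesis using that \<open>same_off _ _ _ \<and> _\<close> by blast
    qed
    \<comment> \<open>The candidates are read from row \<open>k\<close>, while the write went to row
      \<open>Suc k\<close>, so the minimum found before the write is still the right one.\<close>
    have "cand x q (\<lambda>k j. rmem s3 ''D'' (k * N + j)) k j i = cand x q ?D k j i" if "i < j" for i
      using that \<open>j < N\<close> by (auto simp: cand_def s3 cell_index_eq simp del: mult_Suc)
    then have new: "cell N s3 x q (Suc k) j"
      using b5(3-5) by (auto simp: dp_cell_def s3 simp del: mult_Suc)
    have v: "imem s' ''b'' 0 = Suc k * N" "imem s' ''j'' 0 = j"
      using off' off b \<open>imem s ''j'' 0 = j\<close> by (simp_all del: mult_Suc)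
    let ?s2 = "rset ''D'' (ival s' (IAdd (ivar ''b'') (ivar ''j''))) (rval s' (rvar ''best'')) s'"
    have s2: "iset ''a'' (ival ?s2 (IAdd (ivar ''b'') (ivar ''j''))) (ival ?s2 (ivar ''arg'')) ?s2 = s3"
      by (simp add: v s3_def del: mult_Suc)
    have "same_off {''i'', ''best'', ''arg'', ''j'', ''D'', ''a''} s' s0"
      by (rule same_off_trans[OF b5(2) conjunct1[OF \<open>same_off _ _ _ \<and> _\<close>]]) auto
    then have s3_off: "same_off {''i'', ''best'', ''arg'', ''j'', ''D'', ''a''} (iset ''j'' 0 (Suc j) s3) s0"
      by (simp add: s3_def)
    have s3_cells: "cell N (iset ''j'' 0 (Suc j) s3) x q k' j'"
      if "k' \<le> j'" "j' < N" "k' \<le> k \<or> k' = Suc k \<and> j' < Suc j" for k' j'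
      using that old[of k' j'] new by (auto simp: less_Suc_eq simp del: mult_Suc)
    have "j * 70 \<le> N * 70" using \<open>j < N\<close> by simp
    then show ?case
      unfolding s2
    proof (intro conjI allI impI, goal_cases)
      case 1
      then show ?case using b5(1) by simp
    next
      case 2
      show ?case using v by (simp add: s3_def)
    next
      case 3
      show ?case by (rule s3_off)
    next
      case (4 k' j')
      then show ?case by (intro s3_cells) auto
    qed
  next
    case 1
    show ?case using off k by simp
  next
    case 2
    show ?case by (rule \<open>imem s ''j'' 0 = j\<close>)
  next
    case 3
    show ?case using \<open>Suc k \<le> j\<close> by simp
  next
    case (4 i)
    then have "rmem s ''S'' (Suc i) = sum q {..<Suc i}" "rmem s ''S'' (Suc j) = sum q {..<Suc j}"
      using S[of "Suc i"] S[of "Suc j"] \<open>j < N\<close> off by auto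
    then show ?case using off p x by (simp add: cand_def del: sum.lessThan_Suc)
  qed
next
  case (6 t s)
  show ?case
  proof (rule Q)
    show "t \<le> 20 + N * (100 + N * 70)" using 6(1) by simp
    show "same_off {''i'', ''best'', ''arg'', ''j'', ''D'', ''a''} s s0" using 6(2) by blast
    fix k' j' assume "k' \<le> Suc k" "k' \<le> j'" "j' < N"
    moreover from this have "k' \<le> k \<or> k' = Suc k \<and> j' < N" by arith
    ultimately show "cell N s x q k' j'" using 6(2) by blast
  qed
next
  case 3
  \<comment> \<open>Initially the invariant claims nothing about row \<open>Suc k\<close>: a cell of
    that row before column \<open>Suc k\<close> violates \<open>k' \<le> j'\<close>.\<close>
  have "cell N (iset ''j'' 0 (Suc k) s0) x q k' j'" if "k' \<le> k" "k' \<le> j'" "j' < N" for k' j'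
    using cells[OF that] by (simp del: mult_Suc)
  then show ?case by (auto simp del: mult_Suc)
qed (use N k in \<open>auto simp: same_offD\<close>)

text \<open>Row 0 is already present, so the loop starts at 1 with the offsets of rows 0 and 1.
  Afterwards \<open>b\<close> has moved one row past the last, which the backtracking
  undoes.\<close>

definition dp_prog :: com where
  "dp_prog = iput ''p'' (INum 0) ;; iput ''b'' (ivar ''N'') ;;
     for_loop ''k'' (INum 1) ''K''
       (row_prog ;; iput ''p'' (ivar ''b'') ;; iput ''b'' (IAdd (ivar ''b'') (ivar ''N'')))"

lemma run_dp:
  assumes N: "imem s0 ''N'' 0 = N" and K: "imem s0 ''K'' 0 = K" "1 \<le> K" "K \<le> N"
    and S: "\<And>p. p \<le> N \<Longrightarrow> rmem s0 ''S'' p = sum q {..<p}"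
    and x: "x = rmem s0 ''x''"
    and D: "\<And>p. p < N \<Longrightarrow> rmem s0 ''D'' p = x p * sum q {..<Suc p}"
    and Q: "\<And>t s. t \<le> 20 + K * (50 + N * (100 + N * 70)) \<Longrightarrow>
      same_off {''i'', ''best'', ''arg'', ''j'', ''D'', ''a'', ''p'', ''b'', ''k''} s s0 \<Longrightarrow>
      imem s ''b'' 0 = K * N \<Longrightarrow>
      (\<And>k j. k < K \<Longrightarrow> k \<le> j \<Longrightarrow> j < N \<Longrightarrow> cell N s x q k j) \<Longrightarrow> Q t s"
  shows "run dp_prog s0 Q"
  unfolding dp_prog_def run_simps
proof (rule run_for[where h = K and l = 1 and B = "37 + N * (100 + N * 70)" and
    I = "\<lambda>k s. same_off {''i'', ''best'', ''arg'', ''j'', ''D'', ''a'', ''p'', ''b'', ''k''} s s0 \<and>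
      imem s ''b'' 0 = k * N \<and> imem s ''p'' 0 = (k - 1) * N \<and>
      (\<forall>k' j. k' < k \<longrightarrow> k' \<le> j \<longrightarrow> j < N \<longrightarrow> cell N s x q k' j)"], goal_cases)
  case (5 k s)
  have off: "imem s a = imem s0 a" "rmem s a = rmem s0 a"
    if "a \<notin> {''i'', ''best'', ''arg'', ''j'', ''D'', ''a'', ''p'', ''b'', ''k''}" for a
    using 5(3) that by (auto simp: same_offD)
  obtain k' where k': "k = Suc k'" using 5(1) by (cases k) auto
  show ?case
    unfolding run_simps
  proof (rule run_row[where k = k' and N = N and x = x and q = q], goal_cases)
    case (9 t s')
    note r = this
    have off': "imem s' a = imem s a" "rmem s' a = rmem s a"
      if "a \<notin> {''i'', ''best'', ''arg'', ''j'', ''D'', ''a''}" for a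
      using r(2) that by (auto simp: same_offD)
    have "same_off {''i'', ''best'', ''arg'', ''j'', ''D'', ''a'', ''p'', ''b'', ''k''} s' s0"
      by (rule same_off_trans[OF r(2) conjunct1[OF 5(3)]]) auto
    then show ?case using r(1,3) 5 N off off' by (auto simp: k')
  qed (use 5 off N K k' x S in auto)
next
  case (6 t s)
  show ?case
  proof (rule Q, goal_cases)
    case 1
    show ?case using 6(1) by simp
  qed (use 6(2) in blast)+
qed (use N K D in \<open>auto simp: same_offD dp_cell_def\<close>)

section \<open>Backtracking and labelling\<close>

text \<open>The last iteration reads an unused cell of row 0 as the next \<open>j\<close>; it is never marked.
  The subtraction is truncated in that iteration only.\<close>

definition mark_prog :: com where
  "mark_prog = iput ''j'' (ISub (ivar ''N'') (INum 1)) ;;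
     iput ''b'' (ISub (ivar ''b'') (ivar ''N'')) ;;
     for_loop ''t'' (INum 0) ''K''
       (ISet ''leader'' (ivar ''j'') (INum 1) ;;
        iput ''j'' (IGet ''a'' (IAdd (ivar ''b'') (ivar ''j''))) ;;
        iput ''b'' (ISub (ivar ''b'') (ivar ''N'')))"

text \<open>Invariant: \<open>L\<close> consists of the marked positions \<open>M\<close> and the
  leaders still to be visited from the current cell. After the last iteration nothing remains,
  whatever \<open>j\<close> then holds.\<close>

lemma run_mark:
  assumes N: "imem s0 ''N'' 0 = N" and K: "imem s0 ''K'' 0 = Suc k"
    and b: "imem s0 ''b'' 0 = Suc k * N"
    and lead: "imem s0 ''leader'' = (\<lambda>_. 0)"
    and L: "L = leaders (\<lambda>k j. imem s0 ''a'' (k * N + j)) k (N - 1)"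
    and Q: "\<And>t s. t \<le> 50 + Suc k * 50 \<Longrightarrow> same_off {''j'', ''b'', ''t'', ''leader''} s s0 \<Longrightarrow>
      (\<And>p. imem s ''leader'' p = of_bool (p \<in> L)) \<Longrightarrow> Q t s"
  shows "run mark_prog s0 Q"
  unfolding mark_prog_def run_simps
proof (rule run_for[where h = "Suc k" and l = 0 and B = 37 and
    I = "\<lambda>t s. same_off {''j'', ''b'', ''t'', ''leader''} s s0 \<and>
      imem s ''b'' 0 = (k - t) * N \<and>
      (\<exists>M. (\<forall>p. imem s ''leader'' p = of_bool (p \<in> M)) \<and>
        L = M \<union> (if t \<le> k then leaders (\<lambda>k j. imem s0 ''a'' (k * N + j)) (k - t) (imem s ''j'' 0) else {}))"],
    goal_cases)
  case (5 t s)
  have off: "imem s a = imem s0 a" "rmem s a = rmem s0 a" if "a \<notin> {''j'', ''b'', ''t'', ''leader''}" for a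
    using 5(3) that by (auto simp: same_offD)
  obtain M where M: "\<And>p. imem s ''leader'' p = of_bool (p \<in> M)"
    "L = M \<union> leaders (\<lambda>k j. imem s0 ''a'' (k * N + j)) (k - t) (imem s ''j'' 0)"
    using 5(2,3) by auto
  have Mb: "imem s ''b'' 0 = (k - t) * N" using 5(3) by simp
  define j where "j = imem s ''j'' 0"
  have "L = insert j M \<union> (if Suc t \<le> k then leaders (\<lambda>k j. imem s0 ''a'' (k * N + j)) (k - Suc t)
      (imem s0 ''a'' ((k - t) * N + j)) else {})"
  proof (cases "Suc t \<le> k")
    case True
    then have "k - t = Suc (k - Suc t)" by simp
    then show ?thesis using True M(2) by (simp add: j_def)
  next
    case False
    then have "k - t = 0" by simp
    then show ?thesis using False M(2) by (simp add: j_def)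
  qed
  \<comment> \<open>Holds for \<open>t = k\<close> as well, where truncation makes both sides
    0.\<close>
  moreover have "(k - t) * N - N = (k - Suc t) * N"
    by (simp add: diff_mult_distrib)
  ultimately show ?case using 5(3,4) Mb off N
    by (auto simp: M(1) j_def[symmetric] intro!: exI[of _ "insert j M"])
next
  case (6 t s)
  then show ?case by (intro Q) auto
qed (use N K L b lead in \<open>auto simp: same_offD intro!: exI[of _ "{}"]\<close>)

text \<open>The counter is advanced only after \<open>p\<close> has been labelled, matching the
  strict inequality in \<open>label\<close>. Indirection through \<open>pos\<close> stores labels by
  input index.\<close>

definition label_prog :: com where
  "label_prog = iput ''c'' (INum 0) ;;
     for_loop ''p'' (INum 0) ''N''
       (ISet ''group'' (IGet ''pos'' (ivar ''p'')) (ivar ''c'') ;;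
        iput ''c'' (IAdd (ivar ''c'') (IGet ''leader'' (ivar ''p''))))"

lemma label_Suc:
  assumes "finite L"
  shows "label L (Suc p) = label L p + of_bool (p \<in> L)"
proof -
  have "{l \<in> L. l < Suc p} = (if p \<in> L then insert p else id) {l \<in> L. l < p}"
    by (auto simp: less_Suc_eq)
  then show ?thesis using assms by (simp add: label_def)
qed

lemma run_label:
  assumes N: "imem s0 ''N'' 0 = N" and inj: "inj_on (imem s0 ''pos'') {..<N}"
    and L: "finite L" "\<And>p. imem s0 ''leader'' p = of_bool (p \<in> L)"
    and Q: "\<And>t s. t \<le> 20 + N * 50 \<Longrightarrow> same_off {''p'', ''c'', ''group''} s s0 \<Longrightarrow>
      (\<And>p. p < N \<Longrightarrow> imem s ''group'' (imem s0 ''pos'' p) = label L p) \<Longrightarrow> Q t s"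
  shows "run label_prog s0 Q"
  unfolding label_prog_def run_simps
proof (rule run_for[where h = N and l = 0 and B = 37 and
    I = "\<lambda>p s. same_off {''p'', ''c'', ''group''} s s0 \<and> imem s ''c'' 0 = label L p \<and>
      (\<forall>p'<p. imem s ''group'' (imem s0 ''pos'' p') = label L p')"], goal_cases)
  case (5 p s)
  have "imem s0 ''pos'' p' \<noteq> imem s0 ''pos'' p" if "p' < p" for p'
    using inj_onD[OF inj, of p' p] that 5(2) by auto
  moreover have "imem s ''pos'' = imem s0 ''pos''" "imem s ''leader'' = imem s0 ''leader''"
    using 5(3) by (auto simp: same_offD)
  moreover have "label L (Suc p) = label L p + imem s0 ''leader'' p"
    using label_Suc[OF L(1)] L(2) by simp
  ultimately show ?case using 5(3,4) by (simp add: less_Suc_eq)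
next
  case (6 t s)
  then show ?case by (intro Q) auto
qed (use N L in \<open>auto simp: same_offD label_def\<close>)

section \<open>The complete program\<close>

definition merge_prog :: "string \<Rightarrow> com" where
  "merge_prog vn = sort_prog vn ;; prefix_prog ;; dp_prog ;; mark_prog ;; label_prog"

text \<open>With \<open>j\<close> a leader, next leaders of positions up to \<open>j\<close> do not
  exceed \<open>j\<close>, so memory beyond \<open>j\<close> cannot matter.\<close>

lemma leader_cost_cong:
  assumes "L \<subseteq> {..j}" "j \<in> L" "\<And>p. p \<le> j \<Longrightarrow> x p = x' p" "\<And>p. p \<le> j \<Longrightarrow> q p = q' p"
  shows "leader_cost x q L j = leader_cost x' q' L j"
  unfolding leader_cost_def
proof (intro sum.cong refl)
  fix p assume "p \<in> {..j}"
  then have "p \<le> j" "next_leader L p \<le> j" using next_leader_props(3)[of j L p] assms(2) by auto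
  then show "q p * x (next_leader L p) = q' p * x' (next_leader L p)" using assms(3,4) by simp
qed

text \<open>As \<open>N\<close> and \<open>K\<close> are at least 1, each lower-order term is at
  most \<open>N ^ 2 * K\<close>. The coefficients then sum to 591.\<close>

lemma time_bound:
  fixes N K :: nat
  assumes "1 \<le> N" "1 \<le> K" "t1 \<le> 10 + N * (N * 47 + 50)" "t2 \<le> 20 + N * 50"
    "t3 \<le> 20 + K * (50 + N * (100 + N * 70))" "t4 \<le> 50 + K * 50" "t5 \<le> 20 + N * 50"
  shows "1 + t1 + (1 + t2 + (1 + t3 + (1 + t4 + t5))) \<le> 600 * (N ^ 2 * K)"
proof -
  define M where "M = N ^ 2 * K"
  have M: "M = K * (N * N)" by (simp add: M_def power2_eq_square)
  have "N * N \<le> M" "K * N \<le> M" "N \<le> N * N" "K \<le> K * N" "1 \<le> N"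
    using assms(1,2) unfolding M by simp_all
  moreover have "t1 \<le> 10 + (47 * (N * N) + 50 * N)" "t3 \<le> 20 + (50 * K + (100 * (K * N) + 70 * M))"
    using assms(3,5) by (simp_all add: M algebra_simps)
  ultimately show ?thesis using assms(4,6,7) unfolding M_def[symmetric] by linarith
qed

text \<open>The outcome is expressed by a sorting permutation \<open>e\<close> and an optimal leader
  set, which keeps intervals and partitions out of the reasoning about memory.\<close>

lemma run_merge:
  assumes N: "imem s0 ''N'' 0 = Suc n" and K: "imem s0 ''K'' 0 = Suc k" "k \<le> n"
    and vn: "vn = ''lower'' \<or> vn = ''upper''" and lead: "imem s0 ''leader'' = (\<lambda>_. 0)"
    and Q: "\<And>t s e L. t \<le> 600 * (Suc n ^ 2 * Suc k) \<Longrightarrow>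
      bij_betw e {..<Suc n} {..<Suc n} \<Longrightarrow>
      (\<And>p p'. p \<le> p' \<Longrightarrow> p' \<le> n \<Longrightarrow> rmem s0 vn (e p) \<le> rmem s0 vn (e p')) \<Longrightarrow>
      L \<subseteq> {..n} \<Longrightarrow> n \<in> L \<Longrightarrow> card L = Suc k \<Longrightarrow>
      (\<And>p. p \<le> n \<Longrightarrow> imem s ''group'' (e p) = label L p) \<Longrightarrow>
      (\<And>L'. L' \<subseteq> {..n} \<Longrightarrow> n \<in> L' \<Longrightarrow> card L' = Suc k \<Longrightarrow>
        leader_cost (\<lambda>p. rmem s0 vn (e p)) (\<lambda>p. rmem s0 ''mass'' (e p)) L n
        \<le> leader_cost (\<lambda>p. rmem s0 vn (e p)) (\<lambda>p. rmem s0 ''mass'' (e p)) L' n) \<Longrightarrow> Q t s"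
  shows "run (merge_prog vn) s0 Q"
  unfolding merge_prog_def run_simps(4)
proof (rule run_sort[OF N vn])
  fix t1 and s1 :: state
  define v where "v = rmem s0 vn"
  define e where "e = imem s1 ''pos''"
  define x where "x = rmem s1 ''x''"
  define q where "q = rmem s1 ''q''"
  assume t1: "t1 \<le> 10 + Suc n * (Suc n * 47 + 50)"
    and o1: "same_off {''i'', ''r'', ''j'', ''pos'', ''x'', ''q''} s1 s0"
    and s1: "\<And>i. i < Suc n \<Longrightarrow> imem s1 ''pos'' (rank (rmem s0 vn) (Suc n) i) = i \<and>
      rmem s1 ''x'' (rank (rmem s0 vn) (Suc n) i) = rmem s0 vn i \<and>
      rmem s1 ''q'' (rank (rmem s0 vn) (Suc n) i) = rmem s0 ''mass'' i"
  note off1 = same_offD[OF o1]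
  let ?r = "rank v (Suc n)"
  have r: "bij_betw ?r {..<Suc n} {..<Suc n}" by (rule bij_betw_rank)
  have er: "e (?r i) = i" if "i < Suc n" for i using s1[OF that] by (simp add: e_def v_def)
  have re: "e p < Suc n \<and> ?r (e p) = p \<and> x p = v (e p) \<and> q p = rmem s0 ''mass'' (e p)" if "p < Suc n" for p
  proof -
    have "p \<in> ?r ` {..<Suc n}" using r that by (simp add: bij_betw_def)
    then obtain i where i: "i < Suc n" "p = ?r i" by auto
    then show ?thesis using er[OF i(1)] s1[OF i(1)] by (simp add: v_def x_def q_def)
  qed
  \<comment> \<open>The contents of \<open>pos\<close> invert the rank.\<close>
  have e: "bij_betw e {..<Suc n} {..<Suc n}"
  proof (rule bij_betw_byWitness[where f' = ?r])
    show "?r ` {..<Suc n} \<subseteq> {..<Suc n}" using r by (simp add: bij_betw_def)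
  qed (use re er in auto)
  have mono: "v (e p) \<le> v (e p')" if "p \<le> p'" "p' \<le> n" for p p'
    using rank_le_imp[of "e p" "Suc n" "e p'" v] re[of p] re[of p'] that by simp
  show "run prefix_prog s1 (\<lambda>t2 s2. run dp_prog s2 (\<lambda>t3 s3. run mark_prog s3 (\<lambda>t4 s4.
    run label_prog s4 (\<lambda>t5. Q (1 + t1 + (1 + t2 + (1 + t3 + (1 + t4 + t5))))))))"
  proof (rule run_prefix[where N = "Suc n"])
    show "imem s1 ''N'' 0 = Suc n" using N by (simp add: off1)
    fix t2 and s2 :: state
    assume t2: "t2 \<le> 20 + Suc n * 50" and o2: "same_off {''p'', ''S'', ''D''} s2 s1"
      and S: "\<And>p. p \<le> Suc n \<Longrightarrow> rmem s2 ''S'' p = sum (rmem s1 ''q'') {..<p}"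
      and D: "\<And>p. p < Suc n \<Longrightarrow> rmem s2 ''D'' p = rmem s1 ''x'' p * sum (rmem s1 ''q'') {..<Suc p}"
    note off2 = same_offD[OF o2]
    show "run dp_prog s2 (\<lambda>t3 s3. run mark_prog s3 (\<lambda>t4 s4.
      run label_prog s4 (\<lambda>t5. Q (1 + t1 + (1 + t2 + (1 + t3 + (1 + t4 + t5)))))))"
    proof (rule run_dp[where N = "Suc n" and K = "Suc k" and q = q and x = x])
      show "imem s2 ''N'' 0 = Suc n" "imem s2 ''K'' 0 = Suc k" "1 \<le> Suc k" "Suc k \<le> Suc n"
        using N K by (simp_all add: off1 off2)
      show "x = rmem s2 ''x''" by (simp add: off2 x_def)
      show "rmem s2 ''S'' p = sum q {..<p}" if "p \<le> Suc n" for p using S[OF that] by (simp add: q_def)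
      show "rmem s2 ''D'' p = x p * sum q {..<Suc p}" if "p < Suc n" for p
        using D[OF that] by (simp add: q_def x_def)
      fix t3 and s3 :: state
      assume t3: "t3 \<le> 20 + Suc k * (50 + Suc n * (100 + Suc n * 70))"
        and o3: "same_off {''i'', ''best'', ''arg'', ''j'', ''D'', ''a'', ''p'', ''b'', ''k''} s3 s2"
        and b: "imem s3 ''b'' 0 = Suc k * Suc n"
        and cells: "\<And>k' j. k' < Suc k \<Longrightarrow> k' \<le> j \<Longrightarrow> j < Suc n \<Longrightarrow> cell (Suc n) s3 x q k' j"
      note off3 = same_offD[OF o3]
      define L where "L = leaders (\<lambda>k j. imem s3 ''a'' (k * Suc n + j)) k n"
      have L: "n \<in> L" "L \<subseteq> {..n}" "card L = Suc k"
        "rmem s3 ''D'' (k * Suc n + n) = leader_cost x q L n"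
        using leaders_attain[of k n x q "\<lambda>k j. rmem s3 ''D'' (k * Suc n + j)"
          "\<lambda>k j. imem s3 ''a'' (k * Suc n + j)"] cells K(2)
        by (simp_all add: L_def less_Suc_eq_le del: mult_Suc mult_Suc_right)
      have fin: "finite L" using L(2) by (rule finite_subset) simp
      have lc: "leader_cost x q M n = leader_cost (\<lambda>p. v (e p)) (\<lambda>p. rmem s0 ''mass'' (e p)) M n"
        if "M \<subseteq> {..n}" "n \<in> M" for M
        using that re by (intro leader_cost_cong) (simp_all add: less_Suc_eq_le)
      \<comment> \<open>The entry of \<open>D\<close> at row \<open>k\<close> and column
        \<open>n\<close> equals the cost of \<open>L\<close> and bounds every competitor from
        below.\<close>
      have opt: "leader_cost x q L n \<le> leader_cost x q L' n" if "L' \<subseteq> {..n}" "n \<in> L'" "card L' = Suc k" for L'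
        using dp_optimal[of k n x q "\<lambda>k j. rmem s3 ''D'' (k * Suc n + j)"
          "\<lambda>k j. imem s3 ''a'' (k * Suc n + j)" L'] cells that L(4)
        by (simp add: less_Suc_eq_le del: mult_Suc mult_Suc_right)
      show "run mark_prog s3 (\<lambda>t4 s4.
        run label_prog s4 (\<lambda>t5. Q (1 + t1 + (1 + t2 + (1 + t3 + (1 + t4 + t5))))))"
      proof (rule run_mark[where N = "Suc n" and k = k and L = L])
        show "imem s3 ''N'' 0 = Suc n" "imem s3 ''K'' 0 = Suc k" "imem s3 ''leader'' = (\<lambda>_. 0)"
          using N K lead by (simp_all add: off1 off2 off3)
        show "imem s3 ''b'' 0 = Suc k * Suc n" by (rule b)
        show "L = leaders (\<lambda>k j. imem s3 ''a'' (k * Suc n + j)) k (Suc n - 1)" by (simp add: L_def)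
        fix t4 and s4 :: state
        assume t4: "t4 \<le> 50 + Suc k * 50" and o4: "same_off {''j'', ''b'', ''t'', ''leader''} s4 s3"
          and mark: "\<And>p. imem s4 ''leader'' p = of_bool (p \<in> L)"
        note off4 = same_offD[OF o4]
        have pos: "imem s4 ''pos'' = e" by (simp add: off2 off3 off4 e_def)
        show "run label_prog s4 (\<lambda>t5. Q (1 + t1 + (1 + t2 + (1 + t3 + (1 + t4 + t5)))))"
        proof (rule run_label[where N = "Suc n" and L = L])
          show "imem s4 ''N'' 0 = Suc n" using N by (simp add: off1 off2 off3 off4)
          show "inj_on (imem s4 ''pos'') {..<Suc n}" using e pos by (simp add: bij_betw_def)
          fix t5 and s5 :: state
          assume t5: "t5 \<le> 20 + Suc n * 50"
            and lab: "\<And>p. p < Suc n \<Longrightarrow> imem s5 ''group'' (imem s4 ''pos'' p) = label L p"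
          have "1 + t1 + (1 + t2 + (1 + t3 + (1 + t4 + t5))) \<le> 600 * (Suc n ^ 2 * Suc k)"
            using t1 t2 t3 t4 t5 by (intro time_bound) auto
          then show "Q (1 + t1 + (1 + t2 + (1 + t3 + (1 + t4 + t5)))) s5"
            using e mono[unfolded v_def] L(2,1,3)
          proof (rule Q)
            show "imem s5 ''group'' (e p) = label L p" if "p \<le> n" for p
              using lab[of p] that pos by simp
            show "leader_cost (\<lambda>p. rmem s0 vn (e p)) (\<lambda>p. rmem s0 ''mass'' (e p)) L n
              \<le> leader_cost (\<lambda>p. rmem s0 vn (e p)) (\<lambda>p. rmem s0 ''mass'' (e p)) L' n"
              if "L' \<subseteq> {..n}" "n \<in> L'" "card L' = Suc k" for L'
              using opt[OF that] lc[OF that(1,2)] lc[OF L(2,1)] by (simp add: v_def)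
          qed
        qed (use fin mark in auto)
      qed
    qed
  qed
qed

theorem proposition1:
  fixes bnd :: "real interval \<Rightarrow> real"
  assumes "bnd = lower \<or> bnd = upper"
  shows "\<exists>(prog :: com) (T :: nat \<Rightarrow> nat \<Rightarrow> nat).
    (\<lambda>(N, K). real (T N K)) \<in> O[principal {(N, K). 1 \<le> K \<and> K \<le> N}](\<lambda>(N, K). real (N ^ 2 * K)) \<and>
    (\<forall>(m :: mass_function) (N :: nat) (A :: nat \<Rightarrow> real interval) (K :: nat) (w :: real).
       is_mass_function m \<longrightarrow> bij_betw A {..<N} (focal m) \<longrightarrow> 1 \<le> K \<longrightarrow> K \<le> N \<longrightarrow> 0 \<le> w \<longrightarrow>
       (\<exists>t s. exec prog (input_state m N A K w) t s \<and> t \<le> T N K \<and>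
          is_arg_min (\<lambda>P. w * (cbar bnd (merged m P) - cbar bnd m))
            (\<lambda>P. partition_on (focal m) P \<and> card P = K)
            (output_groups N A K s)))"
proof -
  \<comment> \<open>The program depends on the choice of bound only; it is uniform in the mass
    function, \<open>N\<close>, \<open>A\<close>, \<open>K\<close> and \<open>w\<close>.\<close>
  define vn where "vn = (if bnd = lower then ''lower'' else ''upper'')"
  have vn: "vn = ''lower'' \<or> vn = ''upper''" by (simp add: vn_def)
  define T where "T = (\<lambda>N K :: nat. 600 * (N ^ 2 * K))"
  have bigo: "(\<lambda>(N, K). real (T N K)) \<in> O[principal {(N, K). 1 \<le> K \<and> K \<le> N}](\<lambda>(N, K). real (N ^ 2 * K))"
    by (rule bigoI[where c = 600]) (auto simp: T_def eventually_principal split: prod.splits)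
  have "run (merge_prog vn) (input_state m N A K w) (\<lambda>t s. t \<le> T N K \<and>
      is_arg_min (\<lambda>P. w * (cbar bnd (merged m P) - cbar bnd m))
        (\<lambda>P. partition_on (focal m) P \<and> card P = K) (output_groups N A K s))"
    if m: "is_mass_function m" and A: "bij_betw A {..<N} (focal m)" and K: "1 \<le> K" "K \<le> N"
      and w: "0 \<le> w" for m N A K w
  proof -
    let ?s0 = "input_state m N A K w"
    obtain n k where nk: "N = Suc n" "K = Suc k" using K by (cases N; cases K) auto
    have v: "rmem ?s0 vn i = bnd (A i)" if "i < N" for i
      using assms that by (auto simp: input_state_def vn_def)
    have mu: "rmem ?s0 ''mass'' i = mass m (A i)" if "i < N" for i
      using that by (simp add: input_state_def)
    show ?thesis
    proof (rule run_merge[where n = n and k = k and vn = vn])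
      fix t e L and s :: state
      assume t: "t \<le> 600 * (Suc n ^ 2 * Suc k)" and e: "bij_betw e {..<Suc n} {..<Suc n}"
        and mono: "\<And>p p'. p \<le> p' \<Longrightarrow> p' \<le> n \<Longrightarrow> rmem ?s0 vn (e p) \<le> rmem ?s0 vn (e p')"
        and L: "L \<subseteq> {..n}" "n \<in> L" "card L = Suc k"
        and lab: "\<And>p. p \<le> n \<Longrightarrow> imem s ''group'' (e p) = label L p"
        and opt: "\<And>L'. L' \<subseteq> {..n} \<Longrightarrow> n \<in> L' \<Longrightarrow> card L' = Suc k \<Longrightarrow>
          leader_cost (\<lambda>p. rmem ?s0 vn (e p)) (\<lambda>p. rmem ?s0 ''mass'' (e p)) L n
          \<le> leader_cost (\<lambda>p. rmem ?s0 vn (e p)) (\<lambda>p. rmem ?s0 ''mass'' (e p)) L' n"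
      have eN: "e p < N" if "p \<le> n" for p
        using e that by (auto simp: bij_betw_def nk)
      let ?e = "\<lambda>p. A (e p)"
      have Ae: "bij_betw ?e {..<Suc n} (focal m)"
        using bij_betw_trans[OF e, of A] A by (simp add: nk comp_def)
      have mono': "bnd (?e p) \<le> bnd (?e p')" if "p \<le> p'" "p' \<le> n" for p p'
        using mono[OF that] v eN that by simp
      have lc: "leader_cost (\<lambda>p. rmem ?s0 vn (e p)) (\<lambda>p. rmem ?s0 ''mass'' (e p)) M n
        = leader_cost (\<lambda>p. bnd (?e p)) (\<lambda>p. mass m (?e p)) M n" if "M \<subseteq> {..n}" "n \<in> M" for M
        using that by (intro leader_cost_cong) (auto simp: v mu eN)
      \<comment> \<open>Labels are stored by input index; substituting \<open>l = e p\<close> turns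
        the output into the blocks over sorted positions.\<close>
      have "{A l | l. l < N \<and> imem s ''group'' l = k'} = {?e p | p. p < Suc n \<and> label L p = k'}" for k'
      proof -
        have "{l. l < N \<and> imem s ''group'' l = k'} = e ` {p. p < Suc n \<and> label L p = k'}"
        proof (intro equalityI subsetI)
          fix l assume l: "l \<in> {l. l < N \<and> imem s ''group'' l = k'}"
          then have "l \<in> e ` {..<Suc n}" using bij_betw_imp_surj_on[OF e] by (simp add: nk)
          then show "l \<in> e ` {p. p < Suc n \<and> label L p = k'}"
            using l lab by (auto simp: less_Suc_eq_le)
        qed (use lab eN in \<open>auto simp: less_Suc_eq_le\<close>)
        then show ?thesis by (auto simp: setcompr_eq_image image_image)
      qed
      then have out: "output_groups N A K s = fibres ?e (label L) (Suc n) (card L)"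
        by (simp add: output_groups_def fibres_def L(3) nk)
      have P: "partition_on (focal m) (output_groups N A K s)" "card (output_groups N A K s) = K"
        using partition_on_fibres[OF Ae label_image[OF L(1,2)]] L(3) nk out by auto
      have le: "cbar bnd (merged m (output_groups N A K s)) \<le> cbar bnd (merged m P)"
        if P: "partition_on (focal m) P" "card P = K" for P
      proof -
        \<comment> \<open>The sandwich: output, leader set \<open>L\<close>, leader set
          \<open>L'\<close> of the competitor, competitor.\<close>
        obtain L' where L': "L' \<subseteq> {..n}" "n \<in> L'" "card L' = card P"
          "leader_cost (\<lambda>p. bnd (?e p)) (\<lambda>p. mass m (?e p)) L' n \<le> cbar bnd (merged m P)"
          by (rule leader_cost_le_cbar_merged[OF assms m Ae mono' P(1)])
        have "cbar bnd (merged m (output_groups N A K s))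
          \<le> leader_cost (\<lambda>p. bnd (?e p)) (\<lambda>p. mass m (?e p)) L n"
          unfolding out by (rule cbar_fibres_le[OF assms m Ae mono' L(1,2)])
        also have "\<dots> \<le> leader_cost (\<lambda>p. bnd (?e p)) (\<lambda>p. mass m (?e p)) L' n"
          using opt[OF L'(1,2)] L'(3) P(2) nk lc[OF L'(1,2)] lc[OF L(1,2)] by simp
        finally show ?thesis using L'(4) by simp
      qed
      \<comment> \<open>Subtracting the constant \<open>cbar bnd m\<close> and scaling by
        \<open>w \<ge> 0\<close> preserve the weak inequality, also for
        \<open>w = 0\<close>.\<close>
      have "\<not> w * (cbar bnd (merged m P) - cbar bnd m)
          < w * (cbar bnd (merged m (output_groups N A K s)) - cbar bnd m)"
        if "partition_on (focal m) P" "card P = K" for P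
        using mult_left_mono[OF le[OF that] w] by (simp add: right_diff_distrib)
      then show "t \<le> T N K \<and> is_arg_min (\<lambda>P. w * (cbar bnd (merged m P) - cbar bnd m))
        (\<lambda>P. partition_on (focal m) P \<and> card P = K) (output_groups N A K s)"
        using t P unfolding is_arg_min_def T_def nk by blast
    qed (use vn nk K in \<open>auto simp: input_state_def\<close>)
  qed
  then show ?thesis using bigo unfolding run_def by blast
qed

end
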